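(* Let $T(x,y):=\sum_{n\ge 1}x^n\sum_{T\in\mathcal{T}^{(2)}(K_{1,3}\times P_n)}y^{\rho(T)}$ be the bivariate generating function for the $2$-colored partitions of the graphs $K_{1,3}\times P_n$. Then $T(x,y)=p(x,y)/q(x,y)$, where \begin{align*} p(x,y) ={}&(2y^4 + 6y^3 + 6y^2 + 2y)x + (-8y^7 + 4y^6 - 28y^5 + 40y^4 - 44y^3 + 4y^2 - 16y)x^2\\ &+ (14y^9 - 22y^8 - 4y^7 + 104y^6 - 106y^5 - 32y^4 + 90y^3 - 52y^2 + 40y)x^3\\ &+ (-8y^{10} - 8y^9 + 124y^8 - 204y^7 + 52y^6 + 64y^5 + 16y^4 - 80y^3 + 92y^2 - 48y)x^4\\ &+ (-10y^{11} + 4y^{10} + 110y^9 - 268y^8 + 112y^7 + 384y^6 - 662y^5 + 468y^4 - 120y^3 - 48y^2 + 30y)x^5\\ &+ (16y^{11} - 28y^{10} - 156y^9 + 656y^8 - 1028y^7 + 708y^6 - 316y^4 + 168y^3 - 12y^2 - 8y)x^6\\ &+ (8y^{11} - 58y^{10} + 228y^9 - 562y^8 + 852y^7 - 756y^6 + 340y^5 - 26y^4 - 36y^3 + 10y^2)x^7 \end{align*} and \begin{align*} q(x,y) ={}& 1 + (-y^4 - y^3 - y^2 - 7y - 9)x + (y^7 + y^6 + 5y^5 + 11y^4 - 4y^3 - 6y^2 + 14y + 28)x^2\\ &+ (-y^9 - 3y^8 + y^7 + 5y^6 - 22y^5 - 11y^4 + 7y^3 + 54y^2 - 18y - 44)x^3\\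 &+ (7y^9 - 17y^8 + 2y^7 + 20y^6 - 32y^5 + 45y^4 + 42y^3 - 105y^2 - y + 39)x^4\\ &+ (y^{11} + 4y^{10} - 24y^9 + 47y^8 - 28y^7 - 62y^6 + 167y^5 - 125y^4 - 50y^3 + 83y^2 + 6y - 19)x^5\\ &+ (y^{11} - 24y^{10} + 94y^9 - 122y^8 - 61y^7 + 365y^6 - 409y^5 + 116y^4 + 116y^3 - 91y^2 + 11y + 4)x^6\\ &+ (-3y^{11} + 23y^{10} - 74y^9 + 95y^8 + 45y^7 - 289y^6 + 355y^5 - 183y^4 + 18y^3 + 18y^2 - 5y)x^7. \end{align*}
   Context: $K_{1,3}$ is the star graph (complete bipartite graph with parts of sizes $1$ and $3$) and $P_n$ the path graph on $n$ vertices. The product $G_1\times G_2$ of graphs $G_1=(V_1,E_1)$, $G_2=(V_2,E_2)$ is the Cartesian product: its vertex set is $V_1\times V_2$, and $(v_1,v_2),(w_1,w_2)$ are adjacent iff ($v_1=w_1$ and $\{v_2,w_2\}\in E_2$) or ($v_2=w_2$ and $\{v_1,w_1\}\in E_1$). For a finite undirected graph $G=(V,E)$, two nonempty disjoint subsets $V_1,V_2\subseteq V$ are neighbors if there is an edge of $G$ with one endpoint in $V_1$ and the other in $V_2$. A $k$-colored partition of $G$ is a partition $V=\bigcup_{i=1}^s V_i$ together with an assignment of one of $k$ colors to each $V_i$ (all vertices of $V_i$ get that color), such that each $V_i$ induces a connected subgraph of $G$ and any two neighboring sets $V_i,V_j$ have different colors. The sets $V_i$ are the blocks, and the size $\rho(T)$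 of a $k$-colored partition $T$ is its number of blocks. $\mathcal{T}^{(k)}(G)$ denotes the set of all $k$-colored partitions of $G$. Generating functions are formal power series in $x$ with coefficients polynomial in $y$. *)

theory Defs
  imports
    "HOL-Library.FuncSet"
    "HOL-Library.Disjoint_Sets"
    "HOL-Computational_Algebra.Computational_Algebra"
begin

record 'a ugraph =
  verts :: "'a set"
  edges :: "'a set set"

definition complete_bipartite :: "nat \<Rightarrow> nat \<Rightarrow> (nat + nat) ugraph" where
  "complete_bipartite m n =
     \<lparr> verts = {..<m} <+> {..<n},
       edges = {{Inl i, Inr j} | i j. i < m \<and> j < n} \<rparr>"

definition path_graph :: "nat \<Rightarrow> nat ugraph" where
  "path_graph n = \<lparr> verts = {1..n}, edges = {{i, i + 1} | i. 1 \<le> i \<and> i + 1 \<le> n} \<rparr>"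

definition cartesian_product :: "'a ugraph \<Rightarrow> 'b ugraph \<Rightarrow> ('a \<times> 'b) ugraph" where
  "cartesian_product G H =
     \<lparr> verts = verts G \<times> verts H,
       edges = {{(v1, v2), (w1, w2)} | v1 v2 w1 w2.
                  (v1, v2) \<in> verts G \<times> verts H \<and> (w1, w2) \<in> verts G \<times> verts H \<and>
                  (v1 = w1 \<and> {v2, w2} \<in> edges H \<or> v2 = w2 \<and> {v1, w1} \<in> edges G)} \<rparr>"

definition induces_connected :: "'a ugraph \<Rightarrow> 'a set \<Rightarrow> bool" where
  "induces_connected G W \<longleftrightarrow>
     (\<forall>u\<in>W. \<forall>v\<in>W. (u, v) \<in> {(a, b). a \<in> W \<and> b \<in> W \<and> {a, b} \<in> edges G}\<^sup>*)"

definition neighbors :: "'a ugraph \<Rightarrow> 'a set \<Rightarrow> 'a set \<Rightarrow> bool" where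
  "neighbors G A B \<longleftrightarrow>
     A \<noteq> {} \<and> B \<noteq> {} \<and> A \<inter> B = {} \<and> (\<exists>a\<in>A. \<exists>b\<in>B. {a, b} \<in> edges G)"

text \<open>
  A colored partition is a pair of the set of blocks and the color assignment. The assignment is
  extensional (\<open>undefined\<close> off the set of blocks), so that distinct pairs are distinct colored
  partitions.
\<close>

definition colored_partitions ::
    "nat \<Rightarrow> 'a ugraph \<Rightarrow> ('a set set \<times> ('a set \<Rightarrow> nat)) set" where
  "colored_partitions k G =
     {(P, c). partition_on (verts G) P \<and> c \<in> P \<rightarrow>\<^sub>E {..<k} \<and>
              (\<forall>B\<in>P. induces_connected G B) \<and>
              (\<forall>A\<in>P. \<forall>B\<in>P. neighbors G A B \<longrightarrow> c A \<noteq> c B)}"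

definition num_blocks :: "'a set set \<times> ('a set \<Rightarrow> nat) \<Rightarrow> nat" where
  "num_blocks T = card (fst T)"

text \<open>
  Power series in \<open>x\<close> (\<open>fps_X\<close>) whose coefficients are polynomials in \<open>y\<close>
  (\<open>[:0, 1:]\<close>).
\<close>

definition partition_genfun :: "int poly fps" where
  "partition_genfun =
     Abs_fps (\<lambda>n. if n = 0 then 0 else
       (\<Sum>T \<in> colored_partitions 2 (cartesian_product (complete_bipartite 1 3) (path_graph n)).
          [:0, 1:] ^ num_blocks T))"

definition p_poly :: "'a::comm_ring_1 \<Rightarrow> 'a \<Rightarrow> 'a" where
  "p_poly x y =
       (2 * y^4 + 6 * y^3 + 6 * y^2 + 2 * y) * x
     + (-8 * y^7 + 4 * y^6 - 28 * y^5 + 40 * y^4 - 44 * y^3 + 4 * y^2 - 16 * y) * x^2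
     + (14 * y^9 - 22 * y^8 - 4 * y^7 + 104 * y^6 - 106 * y^5 - 32 * y^4 + 90 * y^3 - 52 * y^2 + 40 * y) * x^3
     + (-8 * y^10 - 8 * y^9 + 124 * y^8 - 204 * y^7 + 52 * y^6 + 64 * y^5 + 16 * y^4 - 80 * y^3 + 92 * y^2 - 48 * y) * x^4
     + (-10 * y^11 + 4 * y^10 + 110 * y^9 - 268 * y^8 + 112 * y^7 + 384 * y^6 - 662 * y^5 + 468 * y^4 - 120 * y^3 - 48 * y^2 + 30 * y) * x^5
     + (16 * y^11 - 28 * y^10 - 156 * y^9 + 656 * y^8 - 1028 * y^7 + 708 * y^6 - 316 * y^4 + 168 * y^3 - 12 * y^2 - 8 * y) * x^6
     + (8 * y^11 - 58 * y^10 + 228 * y^9 - 562 * y^8 + 852 * y^7 - 756 * y^6 + 340 * y^5 - 26 * y^4 - 36 * y^3 + 10 * y^2) * x^7"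

definition q_poly :: "'a::comm_ring_1 \<Rightarrow> 'a \<Rightarrow> 'a" where
  "q_poly x y = 1
     + (- (y^4) - y^3 - y^2 - 7 * y - 9) * x
     + (y^7 + y^6 + 5 * y^5 + 11 * y^4 - 4 * y^3 - 6 * y^2 + 14 * y + 28) * x^2
     + (- (y^9) - 3 * y^8 + y^7 + 5 * y^6 - 22 * y^5 - 11 * y^4 + 7 * y^3 + 54 * y^2 - 18 * y - 44) * x^3
     + (7 * y^9 - 17 * y^8 + 2 * y^7 + 20 * y^6 - 32 * y^5 + 45 * y^4 + 42 * y^3 - 105 * y^2 - y + 39) * x^4
     + (y^11 + 4 * y^10 - 24 * y^9 + 47 * y^8 - 28 * y^7 - 62 * y^6 + 167 * y^5 - 125 * y^4 - 50 * y^3 + 83 * y^2 + 6 * y - 19) * x^5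
     + (y^11 - 24 * y^10 + 94 * y^9 - 122 * y^8 - 61 * y^7 + 365 * y^6 - 409 * y^5 + 116 * y^4 + 116 * y^3 - 91 * y^2 + 11 * y + 4) * x^6
     + (-3 * y^11 + 23 * y^10 - 74 * y^9 + 95 * y^8 + 45 * y^7 - 289 * y^6 + 355 * y^5 - 183 * y^4 + 18 * y^3 + 18 * y^2 - 5 * y) * x^7"

end

theory Submission
  imports Defs
begin

text \<open>
  A \<open>k\<close>-colored partition is the same as a vertex coloring: its blocks are the monochromatic
  components. Adding a vertex \<open>v\<close> to a colored graph merges the components that contain a neighbor
  of \<open>v\<close> of the same color into one, so the number of components can be followed while the
  product is built up layer by layer, three leaves first and then the center.

  All that matters about the layers already present is the coloring of the last layer and which of
  its leaves are connected. Up to symmetry there are seven such states: a state is recorded as the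
  pair of the number of leaves whose color differs from the center and the number of connected pairs
  of leaves. This gives a transfer matrix \<open>M\<close> of size 7, the polynomial \<open>q\<close> is
  \<open>det (1 - x M)\<close>, and the theorem amounts to the Cayley-Hamilton relation for the row vector
  \<open>(1, \<dots>, 1)\<close>.
\<close>

section \<open>Monochromatic components\<close>

text \<open>\<open>rtrancl\<close> is reflexive on the whole type, so it is cut down to
  \<open>W\<close> to be an equivalence relation there. Adjacency is a bare predicate, so that it
  stays fixed while \<open>W\<close> grows vertex by vertex.\<close>

definition conn :: "('a \<Rightarrow> 'a \<Rightarrow> bool) \<Rightarrow> ('a \<Rightarrow> 'c) \<Rightarrow> 'a set \<Rightarrow> 'a rel" where
  "conn adj f W = Restr ({(a, b). a \<in> W \<and> b \<in> W \<and> adj a b \<and> f a = f b}\<^sup>*) W"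

definition ncomp :: "('a \<Rightarrow> 'a \<Rightarrow> bool) \<Rightarrow> ('a \<Rightarrow> 'c) \<Rightarrow> 'a set \<Rightarrow> nat" where
  "ncomp adj f W = card (W // conn adj f W)"

lemma conn_subset: "(a, b) \<in> conn adj f W \<Longrightarrow> a \<in> W \<and> b \<in> W"
  by (auto simp: conn_def)

lemma conn_refl: "a \<in> W \<Longrightarrow> (a, a) \<in> conn adj f W"
  by (auto simp: conn_def)

lemma conn_trans: "(a, b) \<in> conn adj f W \<Longrightarrow> (b, c) \<in> conn adj f W \<Longrightarrow> (a, c) \<in> conn adj f W"
  by (auto simp: conn_def)

lemma conn_sym:
  assumes "symp adj" "(a, b) \<in> conn adj f W"
  shows "(b, a) \<in> conn adj f W"
proof -
  have "sym {(a, b). a \<in> W \<and> b \<in> W \<and> adj a b \<and> f a = f b}"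
    using assms(1) by (auto simp: sym_def symp_def)
  then show ?thesis
    using assms(2) sym_rtrancl unfolding conn_def by (blast dest: symD)
qed

lemma conn_edge:
  "a \<in> W \<Longrightarrow> b \<in> W \<Longrightarrow> adj a b \<Longrightarrow> f a = f b \<Longrightarrow> (a, b) \<in> conn adj f W"
  by (auto simp: conn_def)

lemma conn_color:
  assumes "(a, b) \<in> conn adj f W"
  shows "f a = f b"
proof -
  from assms have "(a, b) \<in> {(a, b). a \<in> W \<and> b \<in> W \<and> adj a b \<and> f a = f b}\<^sup>*"
    by (auto simp: conn_def)
  then show ?thesis by induction auto
qed

lemma equiv_conn: "symp adj \<Longrightarrow> equiv W (conn adj f W)"
  by (intro equivI refl_onI symI transI)
     (auto intro: conn_refl conn_trans conn_sym dest: conn_subset)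

text \<open>An equivalence relation containing all monochromatic edges contains all monochromatic
  paths, by induction along the path. It supplies the upper bounds on \<open>conn\<close>
  below.\<close>

lemma conn_least:
  assumes "equiv W R"
    and "\<And>a b. a \<in> W \<Longrightarrow> b \<in> W \<Longrightarrow> adj a b \<Longrightarrow> f a = f b \<Longrightarrow> (a, b) \<in> R"
  shows "conn adj f W \<subseteq> R"
proof
  fix z assume "z \<in> conn adj f W"
  then obtain a b where z: "z = (a, b)" and ab: "a \<in> W"
    "(a, b) \<in> {(a, b). a \<in> W \<and> b \<in> W \<and> adj a b \<and> f a = f b}\<^sup>*"
    by (auto simp: conn_def)
  from ab(2) ab(1) have "(a, b) \<in> R"
  proof induction
    case base
    with assms(1) show ?case by (auto simp: equiv_def refl_on_def)
  next
    case (step b c)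
    then show ?case using assms by (auto simp: equiv_def dest: transD)
  qed
  with z show "z \<in> R" by simp
qed

lemma conn_cong:
  assumes "\<And>a. a \<in> W \<Longrightarrow> f a = g a"
    and "\<And>a b. a \<in> W \<Longrightarrow> b \<in> W \<Longrightarrow> adj a b = adj' a b"
  shows "conn adj f W = conn adj' g W"
proof -
  have "{(a, b). a \<in> W \<and> b \<in> W \<and> adj a b \<and> f a = f b} =
        {(a, b). a \<in> W \<and> b \<in> W \<and> adj' a b \<and> g a = g b}"
    using assms by auto
  then show ?thesis by (simp add: conn_def)
qed

lemma ncomp_cong:
  assumes "\<And>a. a \<in> W \<Longrightarrow> f a = g a"
    and "\<And>a b. a \<in> W \<Longrightarrow> b \<in> W \<Longrightarrow> adj a b = adj' a b"
  shows "ncomp adj f W = ncomp adj' g W"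
  unfolding ncomp_def using conn_cong[of W f g adj adj', OF assms] by simp

text \<open>\<open>C\<close> is the class of the new element: \<open>v\<close> together with all old
  classes meeting \<open>S\<close>. As \<open>C\<close> without \<open>v\<close> is a union of
  classes of \<open>R\<close>, adding \<open>C \<times> C\<close> creates no further chains, and
  classes missing \<open>S\<close> survive unchanged.\<close>

lemma equiv_insert_merge:
  assumes "equiv W R" "v \<notin> W" "S \<subseteq> W"
  defines "C \<equiv> insert v (R `` S)"
  shows "equiv (insert v W) (R \<union> C \<times> C)"
    and "insert v W // (R \<union> C \<times> C) = insert C (W // R - (\<lambda>s. R `` {s}) ` S)"
proof -
  let ?R = "R \<union> C \<times> C"
  have RW: "R \<subseteq> W \<times> W" and refl: "\<And>a. a \<in> W \<Longrightarrow> (a, a) \<in> R"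
    and sym: "\<And>a b. (a, b) \<in> R \<Longrightarrow> (b, a) \<in> R"
    and trans: "\<And>a b c. (a, b) \<in> R \<Longrightarrow> (b, c) \<in> R \<Longrightarrow> (a, c) \<in> R"
    using assms(1) by (auto simp: equiv_def refl_on_def dest: symD transD)
  have CW: "C \<subseteq> insert v W" using RW by (auto simp: C_def)
  have Rcl: "b \<in> C" if "(a, b) \<in> R" "a \<in> C" for a b
    using that RW assms(2) trans unfolding C_def by blast
  show "equiv (insert v W) ?R"
  proof (intro equivI refl_onI symI transI)
    show "?R \<subseteq> insert v W \<times> insert v W" using RW CW by auto
  next
    fix a assume "a \<in> insert v W"
    then show "(a, a) \<in> ?R" using refl by (auto simp: C_def)
  next
    fix a b assume "(a, b) \<in> ?R"
    then show "(b, a) \<in> ?R" using sym by auto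
  next
    fix a b c assume "(a, b) \<in> ?R" "(b, c) \<in> ?R"
    then show "(a, c) \<in> ?R" using Rcl sym trans by blast
  qed
  have inC: "?R `` {a} = C" if "a \<in> C" for a using that Rcl by auto
  have notC: "?R `` {a} = R `` {a}" if "a \<notin> C" for a using that by auto
  have hit: "R `` {a} \<in> (\<lambda>s. R `` {s}) ` S \<longleftrightarrow> a \<in> C" if aW: "a \<in> W" for a
  proof
    assume "R `` {a} \<in> (\<lambda>s. R `` {s}) ` S"
    then obtain s where "s \<in> S" "R `` {a} = R `` {s}" by auto
    then have "(s, a) \<in> R" using refl[OF aW] by auto
    then show "a \<in> C" using \<open>s \<in> S\<close> by (auto simp: C_def)
  next
    assume "a \<in> C"
    then obtain s where "s \<in> S" "(s, a) \<in> R" using aW assms(2) by (auto simp: C_def)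
    then have "R `` {a} = R `` {s}" using sym trans by blast
    then show "R `` {a} \<in> (\<lambda>s. R `` {s}) ` S" using \<open>s \<in> S\<close> by auto
  qed
  show "insert v W // ?R = insert C (W // R - (\<lambda>s. R `` {s}) ` S)" (is "?L = ?M")
  proof
    show "?L \<subseteq> ?M"
    proof
      fix X assume "X \<in> ?L"
      then obtain a where a: "a \<in> insert v W" "X = ?R `` {a}" by (auto simp: quotient_def)
      show "X \<in> ?M"
      proof (cases "a \<in> C")
        case True then show ?thesis using a inC by simp
      next
        case False
        then have "a \<in> W" using a by (auto simp: C_def)
        then show ?thesis using False a notC hit by (auto simp: quotient_def)
      qed
    qed
  next
    show "?M \<subseteq> ?L"
    proof
      fix X assume "X \<in> ?M"
      then consider "X = C" | a where "a \<in> W" "X = R `` {a}" "X \<notin> (\<lambda>s. R `` {s}) ` S"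
        by (auto simp: quotient_def)
      then show "X \<in> ?L"
      proof cases
        case 1
        then have "X = ?R `` {v}" using inC[of v] by (simp add: C_def)
        then show ?thesis by (auto simp: quotient_def)
      next
        case 2
        then have "X = ?R `` {a}" using hit notC by simp
        then show ?thesis using 2 by (auto simp: quotient_def)
      qed
    qed
  qed
qed

lemma conn_insert:
  fixes f :: "'a \<Rightarrow> 'c"
  assumes "symp adj" "v \<notin> W" "\<not> adj v v"
  defines "S \<equiv> {w \<in> W. adj v w \<and> f v = f w}"
  defines "C \<equiv> insert v (conn adj f W `` S)"
  shows "conn adj f (insert v W) = conn adj f W \<union> C \<times> C"
proof
  let ?R = "conn adj f W" and ?R' = "conn adj f (insert v W)"
  have SW: "S \<subseteq> W" by (auto simp: S_def)
  show "?R' \<subseteq> ?R \<union> C \<times> C"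
  proof (rule conn_least)
    show "equiv (insert v W) (?R \<union> C \<times> C)"
      unfolding C_def by (rule equiv_insert_merge(1)[OF equiv_conn[OF assms(1)] assms(2) SW])
  next
    fix a b assume ab: "a \<in> insert v W" "b \<in> insert v W" "adj a b" "f a = f b"
    have SC: "S \<subseteq> C" using SW by (auto simp: C_def intro: conn_refl)
    have "adj b a" using ab assms(1) by (auto dest: sympD)
    then consider "a \<in> W" "b \<in> W" | "a = v" "b \<in> S" | "a \<in> S" "b = v"
      using ab assms(3) by (auto simp: S_def)
    then show "(a, b) \<in> ?R \<union> C \<times> C"
      using ab SC by cases (auto intro: conn_edge simp: C_def)
  qed
  have RR: "?R \<subseteq> ?R'"
  proof (rule subrelI)
    fix a b assume *: "(a, b) \<in> ?R"
    have "{(a, b). a \<in> W \<and> b \<in> W \<and> adj a b \<and> f a = f b} \<subseteq>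
          {(a, b). a \<in> insert v W \<and> b \<in> insert v W \<and> adj a b \<and> f a = f b}" by auto
    from rtrancl_mono[OF this] show "(a, b) \<in> ?R'"
      using * unfolding conn_def by blast
  qed
  have vC: "(v, a) \<in> ?R'" if aC: "a \<in> C" for a
  proof (cases "a = v")
    case True then show ?thesis by (simp add: conn_refl)
  next
    case False
    then obtain s where s: "s \<in> S" "(s, a) \<in> ?R" using aC by (auto simp: C_def)
    then have "(v, s) \<in> ?R'" by (intro conn_edge) (auto simp: S_def)
    then show ?thesis using s RR by (blast intro: conn_trans)
  qed
  have "(a, b) \<in> ?R'" if "a \<in> C" "b \<in> C" for a b
    using vC[OF that(1)] vC[OF that(2)] conn_sym[OF assms(1)] conn_trans by metis
  then show "?R \<union> C \<times> C \<subseteq> ?R'" using RR by auto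
qed

text \<open>One new class replaces the distinct classes that contain a neighbor of \<open>v\<close>
  of its color. The equation is additive because subtraction on \<open>nat\<close>
  truncates.\<close>

lemma ncomp_insert:
  fixes f :: "'a \<Rightarrow> 'c"
  assumes "symp adj" "v \<notin> W" "\<not> adj v v" "finite W"
  defines "S \<equiv> {w \<in> W. adj v w \<and> f v = f w}"
  shows "ncomp adj f (insert v W) + card ((\<lambda>s. conn adj f W `` {s}) ` S) = Suc (ncomp adj f W)"
proof -
  let ?R = "conn adj f W" and ?C = "insert v (conn adj f W `` S)"
  let ?Q = "(\<lambda>s. ?R `` {s}) ` S"
  have eq: "equiv W ?R" by (rule equiv_conn[OF assms(1)])
  have SW: "S \<subseteq> W" by (auto simp: S_def)
  have fin: "finite (W // ?R)" using assms(4) by (simp add: quotient_def)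
  have sub: "?Q \<subseteq> W // ?R" using SW by (auto simp: quotient_def)
  \<comment> \<open>\<open>?C\<close> contains \<open>v\<close>, which no old class does, so
    inserting it really adds one.\<close>
  have "?C \<notin> W // ?R" using assms(2) eq by (auto simp: quotient_def dest: conn_subset)
  moreover have "insert v W // conn adj f (insert v W) = insert ?C (W // ?R - ?Q)"
    using equiv_insert_merge(2)[OF eq assms(2) SW] 
    unfolding S_def conn_insert[OF assms(1-3), of f] .
  ultimately have "ncomp adj f (insert v W) = Suc (card (W // ?R - ?Q))"
    using fin by (simp add: ncomp_def)
  also have "card (W // ?R - ?Q) = ncomp adj f W - card ?Q"
    using fin sub by (simp add: ncomp_def card_Diff_subset finite_subset)
  finally show ?thesis
    using card_mono[OF fin sub] by (simp add: ncomp_def)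
qed

text \<open>Lets the classes met by a set be counted one element at a time, as is done later for the
  neighbors of a new center.\<close>

lemma card_classes_insert:
  assumes "equiv W R" "a \<in> W" "S \<subseteq> W" "finite S"
  shows "card ((\<lambda>s. R `` {s}) ` insert a S) =
         card ((\<lambda>s. R `` {s}) ` S) + (if \<exists>s\<in>S. (a, s) \<in> R then 0 else 1)"
proof -
  have "R `` {a} \<in> (\<lambda>s. R `` {s}) ` S \<longleftrightarrow> (\<exists>s\<in>S. (a, s) \<in> R)"
    using assms eq_equiv_class_iff[OF assms(1,2)] by (auto simp: image_iff)
  then show ?thesis using assms(4) by (auto simp: insert_absorb)
qed

text \<open>With at most one neighbor in \<open>W\<close>, the vertex \<open>v\<close> joins the
  class of \<open>u\<close> or stays alone, and never merges two classes. The vertex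
  \<open>u\<close> may lie outside \<open>W\<close>: this happens in the first layer, where there
  are no predecessors.\<close>

lemma conn_insert_pendant:
  assumes "symp adj" "v \<notin> W" "\<not> adj v v"
    and u: "\<And>w. w \<in> W \<Longrightarrow> adj v w \<longleftrightarrow> w = u"
  shows "(a, b) \<in> conn adj f (insert v W) \<longleftrightarrow>
    (a, b) \<in> conn adj f W \<or> a = v \<and> b = v \<or>
    f u = f v \<and> (a = v \<and> (u, b) \<in> conn adj f W \<or> b = v \<and> (u, a) \<in> conn adj f W)"
proof -
  define S where "S = {w \<in> W. adj v w \<and> f v = f w}"
  have S_eq: "S = (if u \<in> W \<and> f u = f v then {u} else {})" using u by (auto simp: S_def)
  have mem: "a \<in> conn adj f W `` S \<longleftrightarrow> f u = f v \<and> (u, a) \<in> conn adj f W" for a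
    by (auto simp: S_eq dest: conn_subset)
  have "(a, b) \<in> conn adj f W" if "(u, a) \<in> conn adj f W" "(u, b) \<in> conn adj f W"
    using conn_trans[OF conn_sym[OF assms(1) that(1)] that(2)] .
  then show ?thesis
    unfolding conn_insert[OF assms(1-3)] S_def[symmetric] Un_iff mem_Sigma_iff insert_iff mem
    by argo
qed

lemma ncomp_insert_pendant:
  assumes "symp adj" "v \<notin> W" "\<not> adj v v" "finite W"
    and u: "\<And>w. w \<in> W \<Longrightarrow> adj v w \<longleftrightarrow> w = u"
  shows "ncomp adj f (insert v W) = ncomp adj f W + of_bool (\<not> (u \<in> W \<and> f u = f v))"
proof -
  have "{w \<in> W. adj v w \<and> f v = f w} = (if u \<in> W \<and> f u = f v then {u} else {})"
    using u by auto
  then show ?thesis using ncomp_insert[OF assms(1-4), of f] by (auto split: if_splits)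
qed

section \<open>Colored partitions as vertex colorings\<close>

text \<open>Blocks are connected and of one color, and edges between different blocks join different
  colors, so the blocks are exactly the monochromatic components of the induced vertex coloring.
  Hence the partition can be recovered from the coloring, and conversely the components of any
  coloring form a colored partition.\<close>

lemma bij_betw_colored_partitions:
  fixes G :: "'a ugraph"
  defines "adj \<equiv> \<lambda>a b. {a, b} \<in> edges G"
  shows "bij_betw (\<lambda>(P, c). \<lambda>v\<in>verts G. c (THE B. B \<in> P \<and> v \<in> B))
           (colored_partitions k G) (verts G \<rightarrow>\<^sub>E {..<k})"
    and "(P, c) \<in> colored_partitions k G \<Longrightarrow>
           verts G // conn adj (\<lambda>v\<in>verts G. c (THE B. B \<in> P \<and> v \<in> B)) (verts G) = P"
proof -
  define V where "V = verts G"
  define col where "col = (\<lambda>(P, c::'a set \<Rightarrow> nat). \<lambda>v\<in>V. c (THE B. B \<in> P \<and> v \<in> B))"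
  have sym: "symp adj" by (simp add: symp_def adj_def insert_commute)
  have col: "col (P, c) v = c B" if "partition_on V P" "B \<in> P" "v \<in> B" for P c B v
  proof -
    have "(THE B. B \<in> P \<and> v \<in> B) = B"
      using that by (intro the_equality) (auto simp: partition_on_def disjoint_def)
    moreover have "v \<in> V" using that by (auto simp: partition_on_def)
    ultimately show ?thesis by (simp add: col_def)
  qed
  have conn_eq: "conn adj (col (P, c)) V = {(a, b). \<exists>B\<in>P. a \<in> B \<and> b \<in> B}"
    if "(P, c) \<in> colored_partitions k G" for P c
  proof
    have P: "partition_on V P" and con: "\<And>B. B \<in> P \<Longrightarrow> induces_connected G B"
      and nb: "\<And>A B. A \<in> P \<Longrightarrow> B \<in> P \<Longrightarrow> neighbors G A B \<Longrightarrow> c A \<noteq> c B"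
      using that by (auto simp: colored_partitions_def V_def)
    show "conn adj (col (P, c)) V \<subseteq> {(a, b). \<exists>B\<in>P. a \<in> B \<and> b \<in> B}"
    proof (rule conn_least[OF equiv_partition_on[OF P]])
      fix a b assume ab: "a \<in> V" "b \<in> V" "adj a b" "col (P, c) a = col (P, c) b"
      from ab(1,2) P obtain A B where AB: "A \<in> P" "a \<in> A" "B \<in> P" "b \<in> B"
        by (auto simp: partition_on_def)
      have "c A = c B" using col[OF P, of A a c] col[OF P, of B b c] AB ab(4) by simp
      have "A = B"
      proof (rule ccontr)
        assume "A \<noteq> B"
        then have "A \<inter> B = {}" using P AB by (auto simp: partition_on_def disjoint_def)
        then have "neighbors G A B" using AB ab(3) by (auto simp: neighbors_def adj_def)
        from nb[OF AB(1,3) this] \<open>c A = c B\<close> show False by simp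
      qed
      then show "(a, b) \<in> {(a, b). \<exists>B\<in>P. a \<in> B \<and> b \<in> B}" using AB by auto
    qed
    show "{(a, b). \<exists>B\<in>P. a \<in> B \<and> b \<in> B} \<subseteq> conn adj (col (P, c)) V"
    proof clarify
      fix a b B assume B: "B \<in> P" "a \<in> B" "b \<in> B"
      have BV: "B \<subseteq> V" using B P by (auto simp: partition_on_def)
      have "{(a, b). a \<in> B \<and> b \<in> B \<and> {a, b} \<in> edges G} \<subseteq>
            {(x, y). x \<in> V \<and> y \<in> V \<and> adj x y \<and> col (P, c) x = col (P, c) y}"
        using BV B(1) col[OF P, of B _ c] by (auto simp: adj_def)
      from rtrancl_mono[OF this] con[OF B(1)] B(2,3) BV
      show "(a, b) \<in> conn adj (col (P, c)) V"
        unfolding conn_def induces_connected_def by blast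
    qed
  qed
  have quot: "V // conn adj (col (P, c)) V = P" if "(P, c) \<in> colored_partitions k G" for P c
    using conn_eq[OF that] that partition_on_eq_quotient[of V P]
    by (simp add: colored_partitions_def V_def)
  then show "(P, c) \<in> colored_partitions k G \<Longrightarrow>
      verts G // conn adj (\<lambda>v\<in>verts G. c (THE B. B \<in> P \<and> v \<in> B)) (verts G) = P"
    by (simp add: col_def V_def)
  have "bij_betw col (colored_partitions k G) (V \<rightarrow>\<^sub>E {..<k})"
    unfolding bij_betw_def
  proof (intro conjI inj_onI equalityI subsetI)
    fix T U assume TU: "T \<in> colored_partitions k G" "U \<in> colored_partitions k G" "col T = col U"
    obtain P c Q d where T: "T = (P, c)" and U: "U = (Q, d)" by fastforce
    have "P = Q" using quot TU T U by metis
    moreover have "c B = d B" for B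
    proof (cases "B \<in> P")
      case True
      have P: "partition_on V P" using TU T by (auto simp: colored_partitions_def V_def)
      then obtain v where "v \<in> B" using True by (metis partition_onD3 ex_in_conv)
      then show ?thesis using col[OF P True] TU(3) T U \<open>P = Q\<close> by metis
    next
      \<comment> \<open>Off \<open>P\<close> both assignments are \<open>undefined\<close>, being
        extensional.\<close>
      case False
      then show ?thesis using TU T U \<open>P = Q\<close> by (auto simp: colored_partitions_def PiE_def extensional_def)
    qed
    ultimately show "T = U" using T U by auto
  next
    fix f assume "f \<in> col ` colored_partitions k G"
    then obtain P c where Pc: "(P, c) \<in> colored_partitions k G" and f: "f = col (P, c)" by auto
    have P: "partition_on V P" and c: "c \<in> P \<rightarrow>\<^sub>E {..<k}"
      using Pc by (auto simp: colored_partitions_def V_def)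
    show "f \<in> V \<rightarrow>\<^sub>E {..<k}"
    proof (rule PiE_I)
      fix v assume "v \<in> V"
      then obtain B where "B \<in> P" "v \<in> B" using P by (auto simp: partition_on_def)
      then show "f v \<in> {..<k}" using col[OF P] c f by auto
    next
      fix v assume "v \<notin> V" then show "f v = undefined" by (simp add: f col_def)
    qed
  next
    fix f assume f: "f \<in> V \<rightarrow>\<^sub>E {..<k}"
    let ?R = "conn adj f V"
    \<comment> \<open>The preimage of \<open>f\<close>: the blocks are the classes of
      \<open>?R\<close>, each colored by a chosen representative; \<open>cB\<close> shows that the
      choice does not matter.\<close>
    define P where "P = V // ?R"
    define c where "c = (\<lambda>B\<in>P. f (SOME v. v \<in> B))"
    have eq: "equiv V ?R" by (rule equiv_conn[OF sym])
    have P: "partition_on V P" unfolding P_def by (rule partition_on_quotient[OF eq])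
    have same: "(u, v) \<in> ?R" if "B \<in> P" "u \<in> B" "v \<in> B" for B u v
      using that eq quotient_eq_iff[OF eq, of B B u v] by (simp add: P_def)
    have cB: "c B = f v" if "B \<in> P" "v \<in> B" for B v
    proof -
      have "(SOME v. v \<in> B) \<in> B" using that(2) by (rule someI)
      from conn_color[OF same[OF that(1) this that(2)]] show ?thesis using that(1) by (simp add: c_def)
    qed
    have "(P, c) \<in> colored_partitions k G"
      unfolding colored_partitions_def mem_Collect_eq case_prod_conv
    proof (intro conjI ballI impI)
      show "partition_on (verts G) P" using P by (simp add: V_def)
      show "c \<in> P \<rightarrow>\<^sub>E {..<k}"
      proof (rule PiE_I)
        fix B assume B: "B \<in> P"
        then obtain v where "v \<in> B" using P by (metis partition_onD3 ex_in_conv)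
        moreover then have "v \<in> V" using B P by (auto simp: partition_on_def)
        ultimately show "c B \<in> {..<k}" using cB[OF B] f by auto
      qed (simp add: c_def)
    next
      fix B assume B: "B \<in> P"
      show "induces_connected G B"
        unfolding induces_connected_def
      proof (intro ballI)
        fix u v assume uv: "u \<in> B" "v \<in> B"
        have "(u, v) \<in> {(a, b). a \<in> V \<and> b \<in> V \<and> adj a b \<and> f a = f b}\<^sup>*"
          using same[OF B uv] by (auto simp: conn_def)
        \<comment> \<open>Membership of the endpoint in \<open>B\<close> is carried through the
          induction so that every edge of the path lies inside \<open>B\<close>.\<close>
        then have "(u, v) \<in> {(a, b). a \<in> B \<and> b \<in> B \<and> {a, b} \<in> edges G}\<^sup>* \<and> v \<in> B"
        proof induction
          case base
          then show ?case using uv by simp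
        next
          case (step a b)
          then have "(a, b) \<in> ?R" by (auto intro: conn_edge)
          then have "b \<in> B" using step.IH B in_quotient_imp_closed[OF eq] unfolding P_def by blast
          then show ?case using step by (auto simp: adj_def intro: rtrancl.rtrancl_into_rtrancl)
        qed
        then show "(u, v) \<in> {(a, b). a \<in> B \<and> b \<in> B \<and> {a, b} \<in> edges G}\<^sup>*" ..
      qed
    next
      fix A B assume AB: "A \<in> P" "B \<in> P" "neighbors G A B"
      then obtain a b where ab: "a \<in> A" "b \<in> B" "adj a b" and dis: "A \<inter> B = {}"
        by (auto simp: neighbors_def adj_def)
      have V: "a \<in> V" "b \<in> V" using AB ab P by (auto simp: partition_on_def)
      show "c A \<noteq> c B"
      proof
        assume "c A = c B"
        then have "f a = f b" using cB AB ab by metis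
        then have "(a, b) \<in> ?R" using V ab by (intro conn_edge)
        then have "b \<in> A" using ab AB in_quotient_imp_closed[OF eq] unfolding P_def by blast
        with ab dis show False by auto
      qed
    qed
    moreover have "col (P, c) = f"
    proof
      fix v
      show "col (P, c) v = f v"
      proof (cases "v \<in> V")
        case True
        then obtain B where "B \<in> P" "v \<in> B" using P by (auto simp: partition_on_def)
        then show ?thesis using col[OF P] cB by simp
      next
        case False
        then show ?thesis using f by (auto simp: col_def)
      qed
    qed
    ultimately show "f \<in> col ` colored_partitions k G" by force
  qed
  then show "bij_betw (\<lambda>(P, c). \<lambda>v\<in>verts G. c (THE B. B \<in> P \<and> v \<in> B))
           (colored_partitions k G) (verts G \<rightarrow>\<^sub>E {..<k})"
    by (simp add: col_def V_def)
qed

lemma sum_colored_partitions: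
  "(\<Sum>T\<in>colored_partitions k G. h (num_blocks T)) =
   (\<Sum>f\<in>verts G \<rightarrow>\<^sub>E {..<k}. h (ncomp (\<lambda>a b. {a, b} \<in> edges G) f (verts G)))"
proof -
  let ?col = "\<lambda>(P, c). \<lambda>v\<in>verts G. c (THE B. B \<in> P \<and> v \<in> B)"
  let ?N = "\<lambda>f. ncomp (\<lambda>a b. {a, b} \<in> edges G) f (verts G)"
  have "num_blocks T = ?N (?col T)" if "T \<in> colored_partitions k G" for T
    using that bij_betw_colored_partitions(2)[of "fst T" "snd T" k G]
    by (simp add: num_blocks_def ncomp_def case_prod_beta)
  then have "(\<Sum>T\<in>colored_partitions k G. h (num_blocks T)) =
      (\<Sum>T\<in>colored_partitions k G. h (?N (?col T)))"
    by (intro sum.cong) simp_all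
  also have "\<dots> = (\<Sum>f\<in>verts G \<rightarrow>\<^sub>E {..<k}. h (?N f))"
    by (rule sum.reindex_bij_betw[OF bij_betw_colored_partitions(1)])
  finally show ?thesis .
qed

section \<open>Adding a layer to the product of a star and a path\<close>

definition star_verts :: "nat \<Rightarrow> ((nat + nat) \<times> nat) set" where
  "star_verts n = {Inl 0, Inr 0, Inr 1, Inr 2} \<times> {1..n}"

text \<open>There is no bound on layers or leaf numbers: one relation describes adjacency in
  \<open>star_verts n\<close> for every \<open>n\<close>, so successive products can be compared.
  \<open>isl\<close> tells the center (\<open>Inl\<close>) from the leaves
  (\<open>Inr\<close>).\<close>

definition star_adj :: "(nat + nat) \<times> nat \<Rightarrow> (nat + nat) \<times> nat \<Rightarrow> bool" where
  "star_adj a b \<longleftrightarrow>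
     fst a = fst b \<and> (snd b = Suc (snd a) \<or> snd a = Suc (snd b)) \<or>
     snd a = snd b \<and> isl (fst a) \<noteq> isl (fst b)"

lemma verts_star_path:
  "verts (cartesian_product (complete_bipartite 1 3) (path_graph n)) = star_verts n"
proof -
  have "{..<1::nat} <+> {..<3::nat} = {Inl 0, Inr 0, Inr 1, Inr 2}"
    by (auto simp: numeral_3_eq_3 less_Suc_eq)
  then show ?thesis
    by (simp add: cartesian_product_def complete_bipartite_def path_graph_def star_verts_def)
qed

lemma edges_star_path:
  assumes "a \<in> star_verts n" "b \<in> star_verts n"
  shows "{a, b} \<in> edges (cartesian_product (complete_bipartite 1 3) (path_graph n)) \<longleftrightarrow>
         star_adj a b"
proof -
  let ?K = "complete_bipartite 1 3" and ?P = "path_graph n"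
  have path: "{i, j} \<in> edges ?P \<longleftrightarrow> j = Suc i \<or> i = Suc j" if "i \<in> {1..n}" "j \<in> {1..n}" for i j
    using that by (auto simp: path_graph_def doubleton_eq_iff)
  have star: "{u, v} \<in> edges ?K \<longleftrightarrow> isl u \<noteq> isl v"
    if "u \<in> {Inl 0, Inr 0, Inr 1, Inr 2}" "v \<in> {Inl 0, Inr 0, Inr 1, Inr 2}" for u v
    using that by (auto simp: complete_bipartite_def doubleton_eq_iff)
  obtain u i v j where ab: "a = (u, i)" "b = (v, j)" by (meson surj_pair)
  have "{a, b} \<in> edges (cartesian_product ?K ?P) \<longleftrightarrow>
      u = v \<and> {i, j} \<in> edges ?P \<or> i = j \<and> {u, v} \<in> edges ?K"
    using assms unfolding verts_star_path[symmetric] ab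
    by (auto simp: cartesian_product_def doubleton_eq_iff insert_commute)
  also have "\<dots> \<longleftrightarrow> star_adj a b"
    using assms path[of i j] star[of u v] by (auto simp: ab star_adj_def star_verts_def)
  finally show ?thesis .
qed

lemma symp_star_adj: "symp star_adj"
  by (auto simp: symp_def star_adj_def)

lemma finite_star_verts [simp]: "finite (star_verts n)"
  by (simp add: star_verts_def)

lemma star_verts_0 [simp]: "star_verts 0 = {}"
  by (simp add: star_verts_def)

text \<open>The center is outermost, hence added last: each new leaf then meets at most its
  predecessor, and only the new center can merge components.\<close>

lemma star_verts_Suc:
  "star_verts (Suc n) =
     insert (Inl 0, Suc n) (insert (Inr 2, Suc n) (insert (Inr 1, Suc n)
       (insert (Inr 0, Suc n) (star_verts n))))"
  by (auto simp: star_verts_def le_Suc_eq)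

definition leaves_conn :: "((nat + nat) \<times> nat \<Rightarrow> 'c) \<Rightarrow> nat \<Rightarrow> nat \<Rightarrow> nat \<Rightarrow> bool" where
  "leaves_conn f n i j \<longleftrightarrow> ((Inr i, n), (Inr j, n)) \<in> conn star_adj f (star_verts n)"

text \<open>The conjunct \<open>0 < n\<close> makes the flag false over the nonexistent layer 0, so
  that the first layer obeys the same rules as the later ones.\<close>

definition kept :: "((nat + nat) \<times> nat \<Rightarrow> 'c) \<Rightarrow> nat \<Rightarrow> nat + nat \<Rightarrow> bool" where
  "kept f n v \<longleftrightarrow> 0 < n \<and> f (v, n) = f (v, Suc n)"

text \<open>A new leaf joins the component of its predecessor if it keeps that color and otherwise
  starts a component. The new center then merges the classes of its neighbors of equal color; the
  sum added on the left counts these classes without repetition, \<open>a i\<close> marking a leaf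
  already joined to the old center.\<close>

lemma star_layer_step:
  fixes f :: "(nat + nat) \<times> nat \<Rightarrow> 'c" and n :: nat
  defines "q \<equiv> \<lambda>i. f (Inr i, Suc n) = f (Inl 0, Suc n)"
    and "p \<equiv> \<lambda>i. kept f n (Inr i)" and "p0 \<equiv> kept f n (Inl 0)"
    and "e \<equiv> leaves_conn f n"
  defines "a \<equiv> \<lambda>i. p0 \<and> p i \<and> f (Inr i, n) = f (Inl 0, n)"
  shows "\<And>i j. (i, j) \<in> {(0, 1), (0, 2), (1, 2)} \<Longrightarrow>
      leaves_conn f (Suc n) i j \<longleftrightarrow> q i \<and> q j \<or> \<not> q i \<and> \<not> q j \<and> p i \<and> p j \<and> e i j"
    and "ncomp star_adj f (star_verts (Suc n)) +
        (of_bool p0 + of_bool (q 0 \<and> \<not> a 0) +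
         of_bool (q 1 \<and> \<not> a 1 \<and> \<not> (q 0 \<and> p 0 \<and> p 1 \<and> e 0 1)) +
         of_bool (q 2 \<and> \<not> a 2 \<and> \<not> (q 0 \<and> p 0 \<and> p 2 \<and> e 0 2) \<and> \<not> (q 1 \<and> p 1 \<and> p 2 \<and> e 1 2))) =
      ncomp star_adj f (star_verts n) +
        (1 + of_bool (\<not> p 0) + of_bool (\<not> p 1) + of_bool (\<not> p 2))"
proof -
  let ?V = "star_verts n"
  let ?l = "\<lambda>i. (Inr i :: nat + nat, Suc n)" and ?c = "(Inl 0 :: nat + nat, Suc n)"
  define W1 where "W1 = insert (?l 0) ?V"
  define W2 where "W2 = insert (?l 1) W1"
  define W3 where "W3 = insert (?l 2) W2"
  let ?C = "\<lambda>W. conn star_adj f W"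
  have top: "m \<le> n" if "(v, m) \<in> ?V" for v m using that by (auto simp: star_verts_def)
  have V_iff: "(v, n) \<in> ?V \<longleftrightarrow> 0 < n" if "v \<in> {Inl 0, Inr 0, Inr 1, Inr 2}" for v
    using that by (auto simp: star_verts_def)
  have new: "(v, Suc n) \<notin> ?V" for v using top by fastforce
  have irr: "\<not> star_adj v v" for v by (simp add: star_adj_def)
  have fin: "finite W1" "finite W2" "finite W3" by (simp_all add: W1_def W2_def W3_def)
  have n1: "?l 0 \<notin> ?V" and n2: "?l 1 \<notin> W1" and n3: "?l 2 \<notin> W2" and n4: "?c \<notin> W3"
    using new by (auto simp: W1_def W2_def W3_def)
  have u1: "star_adj (?l 0) w \<longleftrightarrow> w = (Inr 0, n)" if "w \<in> ?V" for w
    using that top by (cases w) (fastforce simp: star_adj_def)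
  have u2: "star_adj (?l 1) w \<longleftrightarrow> w = (Inr 1, n)" if "w \<in> W1" for w
    using that top by (cases w) (fastforce simp: star_adj_def W1_def)
  have u3: "star_adj (?l 2) w \<longleftrightarrow> w = (Inr 2, n)" if "w \<in> W2" for w
    using that top by (cases w) (fastforce simp: star_adj_def W1_def W2_def)
  note C1 = conn_insert_pendant[OF symp_star_adj n1 irr u1, of _ _ f, folded W1_def]
  note C2 = conn_insert_pendant[OF symp_star_adj n2 irr u2, of _ _ f, folded W2_def]
  note C3 = conn_insert_pendant[OF symp_star_adj n3 irr u3, of _ _ f, folded W3_def]
  have notV: "((v, Suc n), b) \<notin> ?C ?V" "(b, (v, Suc n)) \<notin> ?C ?V" for v b
    using new by (auto dest: conn_subset)
  have symV: "(x, y) \<in> ?C ?V \<longleftrightarrow> (y, x) \<in> ?C ?V" for x y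
    using conn_sym[OF symp_star_adj] by blast
  have posV: "0 < n" if "((Inr i, n), b) \<in> ?C ?V" for i b
    using conn_subset[OF that] by (auto simp: star_verts_def)
  \<comment> \<open>Before the center arrives, new leaves can be joined only through their
    predecessors.\<close>
  have CL: "(?l i, ?l j) \<in> ?C W3 \<longleftrightarrow> p i \<and> p j \<and> e i j"
    if "(i, j) \<in> {(0, 1), (0, 2), (1, 2)}" for i j
    using that posV symV[of "(Inr j, n)" "(Inr i, n)"]
    by (auto simp: C1 C2 C3 notV p_def e_def kept_def leaves_conn_def)
  have CL': "(?l j, ?l i) \<in> ?C W3 \<longleftrightarrow> p i \<and> p j \<and> e i j"
    if "(i, j) \<in> {(0, 1), (0, 2), (1, 2)}" for i j
    using CL[OF that] conn_sym[OF symp_star_adj] by blast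
  \<comment> \<open>An old leaf and the old center are adjacent, so equal colors already connect
    them.\<close>
  have centre: "((Inr i, n), (Inl 0, n)) \<in> ?C ?V \<longleftrightarrow> 0 < n \<and> f (Inr i, n) = f (Inl 0, n)"
    if "i \<in> {0, 1, 2}" for i
    using that by (auto simp: V_iff star_adj_def dest: conn_color posV intro!: conn_edge)
  have CC: "(?l i, (Inl 0, n)) \<in> ?C W3 \<longleftrightarrow> p i \<and> f (Inr i, n) = f (Inl 0, n)"
    if "i \<in> {0, 1, 2}" for i
    using that centre[OF that] by (auto simp: C1 C2 C3 notV p_def kept_def)
  define S where "S = {w \<in> W3. star_adj ?c w \<and> f ?c = f w}"
  have S_iff: "w \<in> S \<longleftrightarrow> (p0 \<and> w = (Inl 0, n)) \<or> (\<exists>i\<in>{0, 1, 2}. q i \<and> w = ?l i)" for w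
  proof -
    have adj_new: "star_adj ?c (?l i)" for i by (simp add: star_adj_def)
    have "w \<in> ?V \<and> star_adj ?c w \<longleftrightarrow> 0 < n \<and> w = (Inl 0, n)"
      using top[of "fst w" "snd w"] by (cases w) (auto simp: star_adj_def star_verts_def)
    then have "w \<in> ?V \<and> star_adj ?c w \<and> f ?c = f w \<longleftrightarrow> p0 \<and> w = (Inl 0, n)"
      by (auto simp: p0_def kept_def)
    moreover have "w \<in> S \<longleftrightarrow> w \<in> ?V \<and> star_adj ?c w \<and> f ?c = f w \<or>
        (\<exists>i\<in>{0, 1, 2}. f ?c = f (?l i) \<and> w = ?l i)"
      using adj_new by (auto simp: S_def W1_def W2_def W3_def)
    moreover have "f ?c = f (?l i) \<longleftrightarrow> q i" for i
      unfolding q_def by (rule eq_commute)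
    ultimately show ?thesis by (simp only:)
  qed
  have eq3: "equiv W3 (?C W3)" by (rule equiv_conn[OF symp_star_adj])
  have inC: "?l i \<in> insert ?c (?C W3 `` S) \<longleftrightarrow> q i" if "i \<in> {0, 1, 2}" for i
  proof
    assume "q i"
    then have "?l i \<in> S" using that by (auto simp: S_iff)
    moreover have "(?l i, ?l i) \<in> ?C W3" using that by (intro conn_refl) (auto simp: W1_def W2_def W3_def)
    ultimately show "?l i \<in> insert ?c (?C W3 `` S)" by auto
  next
    assume "?l i \<in> insert ?c (?C W3 `` S)"
    then obtain s where "s \<in> S" "(s, ?l i) \<in> ?C W3" by auto
    then show "q i" using conn_color by (fastforce simp: S_def q_def)
  qed
  have V': "star_verts (Suc n) = insert ?c W3"
    by (simp add: star_verts_Suc W1_def W2_def W3_def)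
  show "leaves_conn f (Suc n) i j \<longleftrightarrow> q i \<and> q j \<or> \<not> q i \<and> \<not> q j \<and> p i \<and> p j \<and> e i j"
    if ij: "(i, j) \<in> {(0, 1), (0, 2), (1, 2)}" for i j
  proof -
    \<comment> \<open>Connected leaves have equal colors, so a connection through the old layer
      occurs only with \<open>q i\<close> and \<open>q j\<close> both true or both false.\<close>
    have "q i \<longleftrightarrow> q j" if "p i \<and> p j \<and> e i j"
      using conn_color[of "?l i" "?l j" star_adj f W3] CL[OF ij] that by (simp add: q_def)
    then show ?thesis
      using ij inC[of i] inC[of j] CL[OF ij]
      unfolding leaves_conn_def V' conn_insert[OF symp_star_adj n4 irr, of f] S_def[symmetric]
      by auto
  qed
  have "ncomp star_adj f (star_verts (Suc n)) + card ((\<lambda>s. ?C W3 `` {s}) ` S) =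
      Suc (ncomp star_adj f W3)"
    unfolding V' S_def by (rule ncomp_insert[OF symp_star_adj n4 irr fin(3)])
  moreover have "ncomp star_adj f W3 = ncomp star_adj f ?V +
      (of_bool (\<not> p 0) + of_bool (\<not> p 1) + of_bool (\<not> p 2))"
    using ncomp_insert_pendant[OF symp_star_adj n1 irr _ u1, of f, folded W1_def]
      ncomp_insert_pendant[OF symp_star_adj n2 irr fin(1) u2, of f, folded W2_def]
      ncomp_insert_pendant[OF symp_star_adj n3 irr fin(2) u3, of f, folded W3_def]
    by (simp add: W1_def W2_def W3_def V_iff p_def kept_def)
  moreover have "card ((\<lambda>s. ?C W3 `` {s}) ` S) =
     of_bool p0 + of_bool (q 0 \<and> \<not> a 0) +
     of_bool (q 1 \<and> \<not> a 1 \<and> \<not> (q 0 \<and> p 0 \<and> p 1 \<and> e 0 1)) +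
     of_bool (q 2 \<and> \<not> a 2 \<and> \<not> (q 0 \<and> p 0 \<and> p 2 \<and> e 0 2) \<and> \<not> (q 1 \<and> p 1 \<and> p 2 \<and> e 1 2))"
  proof -
    \<comment> \<open>\<open>S\<close> is built from the old center by adding leaves 0, 1, 2 in
      turn, so each leaf is compared only with the elements before it.\<close>
    define S0 where "S0 = (if p0 then {(Inl 0 :: nat + nat, n)} else {})"
    define S1 where "S1 = (if q 0 then insert (?l 0) S0 else S0)"
    define S2 where "S2 = (if q 1 then insert (?l 1) S1 else S1)"
    have S: "S = (if q 2 then insert (?l 2) S2 else S2)"
      by (auto simp: S_iff S0_def S1_def S2_def)
    have fS: "finite S0" "finite S1" "finite S2" by (simp_all add: S0_def S1_def S2_def)
    have lW: "?l 0 \<in> W3" "?l 1 \<in> W3" "?l 2 \<in> W3" by (simp_all add: W1_def W2_def W3_def)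
    have "S \<subseteq> W3" by (auto simp: S_def)
    then have sub: "S0 \<subseteq> W3" "S1 \<subseteq> W3" "S2 \<subseteq> W3"
      by (auto simp: S S0_def S1_def S2_def split: if_splits)
    have r0: "(\<exists>s\<in>S0. (?l 0, s) \<in> ?C W3) \<longleftrightarrow> a 0"
      and r1: "(\<exists>s\<in>S1. (?l 1, s) \<in> ?C W3) \<longleftrightarrow> a 1 \<or> q 0 \<and> p 0 \<and> p 1 \<and> e 0 1"
      and r2: "(\<exists>s\<in>S2. (?l 2, s) \<in> ?C W3) \<longleftrightarrow>
        a 2 \<or> q 0 \<and> p 0 \<and> p 2 \<and> e 0 2 \<or> q 1 \<and> p 1 \<and> p 2 \<and> e 1 2"
      using CC[of 0] CC[of 1] CC[of 2] CL'[of 0 1] CL'[of 0 2] CL'[of 1 2]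
      by (auto simp: S0_def S1_def S2_def a_def)
    have k0: "card ((\<lambda>s. ?C W3 `` {s}) ` S0) = of_bool p0" by (simp add: S0_def)
    have k1: "card ((\<lambda>s. ?C W3 `` {s}) ` S1) =
        card ((\<lambda>s. ?C W3 `` {s}) ` S0) + of_bool (q 0 \<and> \<not> a 0)"
      using card_classes_insert[OF eq3 lW(1) sub(1) fS(1)] r0 by (simp add: S1_def)
    have k2: "card ((\<lambda>s. ?C W3 `` {s}) ` S2) = card ((\<lambda>s. ?C W3 `` {s}) ` S1) +
        of_bool (q 1 \<and> \<not> a 1 \<and> \<not> (q 0 \<and> p 0 \<and> p 1 \<and> e 0 1))"
      using card_classes_insert[OF eq3 lW(2) sub(2) fS(2)] r1 by (simp add: S2_def)
    have k3: "card ((\<lambda>s. ?C W3 `` {s}) ` S) = card ((\<lambda>s. ?C W3 `` {s}) ` S2) +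
        of_bool (q 2 \<and> \<not> a 2 \<and> \<not> (q 0 \<and> p 0 \<and> p 2 \<and> e 0 2) \<and> \<not> (q 1 \<and> p 1 \<and> p 2 \<and> e 1 2))"
      using card_classes_insert[OF eq3 lW(3) sub(3) fS(3)] r2 by (simp add: S)
    show ?thesis unfolding k3 k2 k1 k0 by simp
  qed
  ultimately show "ncomp star_adj f (star_verts (Suc n)) +
        (of_bool p0 + of_bool (q 0 \<and> \<not> a 0) +
         of_bool (q 1 \<and> \<not> a 1 \<and> \<not> (q 0 \<and> p 0 \<and> p 1 \<and> e 0 1)) +
         of_bool (q 2 \<and> \<not> a 2 \<and> \<not> (q 0 \<and> p 0 \<and> p 2 \<and> e 0 2) \<and> \<not> (q 1 \<and> p 1 \<and> p 2 \<and> e 1 2))) =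
      ncomp star_adj f (star_verts n) +
        (1 + of_bool (\<not> p 0) + of_bool (\<not> p 1) + of_bool (\<not> p 2))"
    by linarith
qed

section \<open>The transfer operator\<close>

text \<open>For \<open>0 < n\<close> the possible values are \<open>(0, 3)\<close>,
  \<open>(1, 1)\<close>, \<open>(2, 0)\<close>, \<open>(2, 1)\<close>, \<open>(3, 0)\<close>,
  \<open>(3, 1)\<close>, \<open>(3, 3)\<close>: leaves of the center's color are connected through
  it, the others at most through earlier layers, and exactly two connected pairs would contradict
  transitivity.\<close>

definition star_type :: "((nat + nat) \<times> nat \<Rightarrow> 'c) \<Rightarrow> nat \<Rightarrow> nat \<times> nat" where
  "star_type f n =
     (of_bool (f (Inr 0, n) \<noteq> f (Inl 0, n)) + of_bool (f (Inr 1, n) \<noteq> f (Inl 0, n)) +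
        of_bool (f (Inr 2, n) \<noteq> f (Inl 0, n)),
      of_bool (leaves_conn f n 0 1) + of_bool (leaves_conn f n 0 2) + of_bool (leaves_conn f n 1 2))"

text \<open>The weight \<open>h\<close> on the final state makes a recursion possible: removing a
  layer replaces \<open>h\<close> by its image under the transfer operator. Constant weight 1 gives
  the coefficients of the series.\<close>

definition star_sum :: "'a::comm_ring_1 \<Rightarrow> (nat \<times> nat \<Rightarrow> 'a) \<Rightarrow> nat \<Rightarrow> 'a" where
  "star_sum y h n = (\<Sum>f\<in>star_verts n \<rightarrow>\<^sub>E {..<2::nat}.
     h (star_type f n) * y ^ ncomp star_adj f (star_verts n))"

text \<open>
  A row vector indexed by the seven states. The last entry is also the value at pairs that are not
  states, so that identities between vectors hold as identities of functions.
\<close>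

definition star_vec ::
    "'a \<Rightarrow> 'a \<Rightarrow> 'a \<Rightarrow> 'a \<Rightarrow> 'a \<Rightarrow> 'a \<Rightarrow> 'a \<Rightarrow> nat \<times> nat \<Rightarrow> 'a" where
  "star_vec a b c d e f g t =
     (if t = (0, 3) then a else
      if t = (1, 1) then b else
      if t = (2, 0) then c else
      if t = (2, 1) then d else
      if t = (3, 0) then e else
      if t = (3, 1) then f else
      g)"

text \<open>
  Multiplication of a row vector by the transfer matrix, scaled by \<open>y\<^sup>2\<close>: adding a layer may lower the
  number of components by up to 2.
\<close>

definition star_transfer ::
    "'a::comm_ring_1 \<Rightarrow> (nat \<times> nat \<Rightarrow> 'a) \<Rightarrow> nat \<times> nat \<Rightarrow> 'a" where
  "star_transfer y h = star_vec
     (y^2 * h (0, 3) + y^3 * h (0, 3) + 6 * y^3 * h (1, 1) + 3 * y^4 * h (2, 0) + 3 * y^3 * h (2, 1) + y^5 * h (3, 0) + y^3 * h (3, 3))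
     (2 * y^2 * h (0, 3) + 3 * y^2 * h (1, 1) + 2 * y^3 * h (1, 1) + y^4 * h (1, 1) + 2 * y^3 * h (2, 0) + 3 * y^4 * h (2, 0) + y^2 * h (2, 1) + y^4 * h (3, 0) + y^4 * h (3, 1))
     (y * h (0, 3) + y^2 * h (0, 3) + y * h (1, 1) + 2 * y^2 * h (1, 1) + 3 * y^3 * h (1, 1) + y^2 * h (2, 0) + 4 * y^3 * h (2, 0) + y^5 * h (2, 0) + y^3 * h (3, 0) + y^5 * h (3, 0))
     (2 * y^2 * h (0, 3) + 3 * y^2 * h (1, 1) + 3 * y^3 * h (1, 1) + 4 * y^3 * h (2, 0) + y^5 * h (2, 0) + y^2 * h (2, 1) + y^5 * h (3, 0) + y^3 * h (3, 1))
     (h (0, 3) + y^2 * h (0, 3) + 6 * y^2 * h (1, 1) + 3 * y^2 * h (2, 0) + 3 * y^4 * h (2, 0) + y^2 * h (3, 0) + y^6 * h (3, 0))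
     (y * h (0, 3) + y^2 * h (0, 3) + 5 * y^2 * h (1, 1) + y^3 * h (1, 1) + 2 * y^2 * h (2, 0) + 3 * y^4 * h (2, 0) + y^2 * h (2, 1) + y^6 * h (3, 0) + y^2 * h (3, 1))
     (2 * y^2 * h (0, 3) + 3 * y^2 * h (1, 1) + 3 * y^3 * h (1, 1) + 3 * y^4 * h (2, 0) + 3 * y^2 * h (2, 1) + y^6 * h (3, 0) + y^2 * h (3, 3))"

text \<open>
  The number of distinct components met by the same-colored neighbors of a new center, among the old
  center and the three new leaves. The flags \<open>p\<close> say that a vertex has the color of its predecessor
  (without index: the center), \<open>q\<close> that a new leaf has the color of the new center, \<open>s\<close> the same in
  the old layer, and \<open>e\<close> that two old leaves are connected.
\<close>

definition layer_merged ::
    "bool \<Rightarrow> bool \<Rightarrow> bool \<Rightarrow> bool \<Rightarrow> bool \<Rightarrow> bool \<Rightarrow> bool \<Rightarrow> bool \<Rightarrow> bool \<Rightarrow> bool \<Rightarrow>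
     bool \<Rightarrow> bool \<Rightarrow> bool \<Rightarrow> nat" where
  "layer_merged p p0 p1 p2 q0 q1 q2 s0 s1 s2 e01 e02 e12 =
     of_bool p + of_bool (q0 \<and> \<not> (p \<and> p0 \<and> s0)) +
     of_bool (q1 \<and> \<not> (p \<and> p1 \<and> s1) \<and> \<not> (q0 \<and> p0 \<and> p1 \<and> e01)) +
     of_bool (q2 \<and> \<not> (p \<and> p2 \<and> s2) \<and> \<not> (q0 \<and> p0 \<and> p2 \<and> e02) \<and> \<not> (q1 \<and> p1 \<and> p2 \<and> e12))"

definition layer_type ::
    "bool \<Rightarrow> bool \<Rightarrow> bool \<Rightarrow> bool \<Rightarrow> bool \<Rightarrow> bool \<Rightarrow> bool \<Rightarrow> bool \<Rightarrow> bool \<Rightarrow> nat \<times> nat" where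
  "layer_type p0 p1 p2 q0 q1 q2 e01 e02 e12 =
     (of_bool (\<not> q0) + of_bool (\<not> q1) + of_bool (\<not> q2),
      of_bool (q0 \<and> q1 \<or> \<not> q0 \<and> \<not> q1 \<and> p0 \<and> p1 \<and> e01) +
      of_bool (q0 \<and> q2 \<or> \<not> q0 \<and> \<not> q2 \<and> p0 \<and> p2 \<and> e02) +
      of_bool (q1 \<and> q2 \<or> \<not> q1 \<and> \<not> q2 \<and> p1 \<and> p2 \<and> e12))"

section \<open>Summing over the colorings of a new layer\<close>

lemma sum_PiE_insert:
  assumes "v \<notin> V"
  shows "(\<Sum>f\<in>insert v V \<rightarrow>\<^sub>E D. g f) = (\<Sum>f\<in>V \<rightarrow>\<^sub>E D. \<Sum>d\<in>D. g (f(v := d)))"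
proof -
  have "(\<Sum>f\<in>insert v V \<rightarrow>\<^sub>E D. g f) = (\<Sum>(d, f)\<in>D \<times> (V \<rightarrow>\<^sub>E D). g (f(v := d)))"
    unfolding PiE_insert_eq
    by (subst sum.reindex[OF inj_combinator[OF assms]]) (simp add: case_prod_beta comp_def)
  also have "\<dots> = (\<Sum>d\<in>D. \<Sum>f\<in>V \<rightarrow>\<^sub>E D. g (f(v := d)))"
    by (simp add: sum.cartesian_product)
  also have "\<dots> = (\<Sum>f\<in>V \<rightarrow>\<^sub>E D. \<Sum>d\<in>D. g (f(v := d)))"
    by (rule sum.swap)
  finally show ?thesis .
qed

lemma star_sum_Suc_expand:
  fixes g :: "((nat + nat) \<times> nat \<Rightarrow> nat) \<Rightarrow> 'a::comm_ring_1"
  shows "(\<Sum>f\<in>star_verts (Suc n) \<rightarrow>\<^sub>E {..<2}. g f) =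
    (\<Sum>f\<in>star_verts n \<rightarrow>\<^sub>E {..<2}. \<Sum>d0<2. \<Sum>d1<2. \<Sum>d2<2. \<Sum>d<2.
       g (f((Inr 0, Suc n) := d0, (Inr 1, Suc n) := d1, (Inr 2, Suc n) := d2, (Inl 0, Suc n) := d)))"
proof -
  have new: "(v, Suc n) \<notin> star_verts n" for v by (auto simp: star_verts_def)
  show ?thesis
    unfolding star_verts_Suc by (simp add: sum_PiE_insert new)
qed

text \<open>The four new colors leave the older layers untouched, so connectivity and component
  count there are those of \<open>f\<close>; the rest is \<open>star_layer_step\<close> for the
  extended coloring.\<close>

lemma star_extend:
  fixes f :: "(nat + nat) \<times> nat \<Rightarrow> nat" and n d0 d1 d2 d :: nat
  defines "F \<equiv> \<lambda>v. f (v, n)" and "e \<equiv> leaves_conn f n"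
  defines "g \<equiv> \<lambda>d0 d1 d2 d. f((Inr 0, Suc n) := d0, (Inr 1, Suc n) := d1, (Inr 2, Suc n) := d2,
      (Inl 0, Suc n) := d)"
  defines "p \<equiv> \<lambda>v d. 0 < n \<and> F v = d"
  shows "star_type (g d0 d1 d2 d) (Suc n) =
      layer_type (p (Inr 0) d0) (p (Inr 1) d1) (p (Inr 2) d2) (d0 = d) (d1 = d) (d2 = d)
        (e 0 1) (e 0 2) (e 1 2)"
    and "ncomp star_adj (g d0 d1 d2 d) (star_verts (Suc n)) +
        layer_merged (p (Inl 0) d) (p (Inr 0) d0) (p (Inr 1) d1) (p (Inr 2) d2)
          (d0 = d) (d1 = d) (d2 = d)
          (F (Inr 0) = F (Inl 0)) (F (Inr 1) = F (Inl 0)) (F (Inr 2) = F (Inl 0))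
          (e 0 1) (e 0 2) (e 1 2) =
      ncomp star_adj f (star_verts n) +
        (1 + of_bool (\<not> p (Inr 0) d0) + of_bool (\<not> p (Inr 1) d1) + of_bool (\<not> p (Inr 2) d2))"
proof -
  have old: "g d0 d1 d2 d v = f v" if "v \<in> star_verts n" for v
    using that by (auto simp: g_def star_verts_def)
  have e': "leaves_conn (g d0 d1 d2 d) n i j = e i j" for i j
    unfolding leaves_conn_def e_def by (subst conn_cong[of "star_verts n" _ f]) (auto simp: old)
  have N: "ncomp star_adj (g d0 d1 d2 d) (star_verts n) = ncomp star_adj f (star_verts n)"
    by (rule ncomp_cong) (auto simp: old)
  have k: "kept (g d0 d1 d2 d) n (Inr 0) = p (Inr 0) d0" "kept (g d0 d1 d2 d) n (Inr 1) = p (Inr 1) d1"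
    "kept (g d0 d1 d2 d) n (Inr 2) = p (Inr 2) d2" "kept (g d0 d1 d2 d) n (Inl 0) = p (Inl 0) d"
    by (auto simp: kept_def g_def p_def F_def)
  have new: "g d0 d1 d2 d (Inr 0, Suc n) = d0" "g d0 d1 d2 d (Inr 1, Suc n) = d1"
    "g d0 d1 d2 d (Inr 2, Suc n) = d2" "g d0 d1 d2 d (Inl 0, Suc n) = d"
    and oldF: "g d0 d1 d2 d (v, n) = F v" for v
    by (auto simp: g_def F_def)
  have pair: "(0, 1) \<in> {(0 :: nat, 1 :: nat), (0, 2), (1, 2)}"
    "(0, 2) \<in> {(0 :: nat, 1 :: nat), (0, 2), (1, 2)}"
    "(1, 2) \<in> {(0 :: nat, 1 :: nat), (0, 2), (1, 2)}" by simp_all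
  show "star_type (g d0 d1 d2 d) (Suc n) =
      layer_type (p (Inr 0) d0) (p (Inr 1) d1) (p (Inr 2) d2) (d0 = d) (d1 = d) (d2 = d)
        (e 0 1) (e 0 2) (e 1 2)"
    unfolding star_type_def layer_type_def new
      star_layer_step(1)[of 0 1, OF pair(1), of "g d0 d1 d2 d" n, unfolded e' k new]
      star_layer_step(1)[of 0 2, OF pair(2), of "g d0 d1 d2 d" n, unfolded e' k new]
      star_layer_step(1)[of 1 2, OF pair(3), of "g d0 d1 d2 d" n, unfolded e' k new] ..
  show "ncomp star_adj (g d0 d1 d2 d) (star_verts (Suc n)) +
        layer_merged (p (Inl 0) d) (p (Inr 0) d0) (p (Inr 1) d1) (p (Inr 2) d2)
          (d0 = d) (d1 = d) (d2 = d)
          (F (Inr 0) = F (Inl 0)) (F (Inr 1) = F (Inl 0)) (F (Inr 2) = F (Inl 0))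
          (e 0 1) (e 0 2) (e 1 2) =
      ncomp star_adj f (star_verts n) +
        (1 + of_bool (\<not> p (Inr 0) d0) + of_bool (\<not> p (Inr 1) d1) + of_bool (\<not> p (Inr 2) d2))"
    using star_layer_step(2)[of "g d0 d1 d2 d" n, unfolded e' k new oldF] unfolding N layer_merged_def .
qed

lemma sum_lessThan_2: "(\<Sum>d<2. g d) = g 0 + g (1 :: nat)" for g :: "nat \<Rightarrow> 'a::comm_monoid_add"
  by (simp add: numeral_2_eq_2)

text \<open>In a single star, leaves that differ from the center are isolated. So there are
  \<open>2 * (3 choose k)\<close> colorings with \<open>k\<close> such leaves, each with
  \<open>k + 1\<close> components.\<close>

lemma star_sum_1:
  "star_sum y h (Suc 0) = 2 * y * h (0, 3) + 6 * y^2 * h (1, 1) + 6 * y^3 * h (2, 0) + 2 * y^4 * h (3, 0)"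
  for y :: "'a::comm_ring_1"
proof -
  \<comment> \<open>The only extensional coloring of the empty graph. Layer 1 is treated as an
    extension of it, with all flags that refer to an earlier layer false.\<close>
  let ?f = "\<lambda>x :: (nat + nat) \<times> nat. undefined :: nat"
  let ?g = "\<lambda>d0 d1 d2 d. ?f((Inr 0, Suc 0) := d0, (Inr 1, Suc 0) := d1, (Inr 2, Suc 0) := d2,
      (Inl 0, Suc 0) := d)"
  have single: "sum g {x} = g x" for g :: "'b \<Rightarrow> 'a" and x by simp
  have none: "leaves_conn ?f 0 i j = False" for i j
    by (auto simp: leaves_conn_def dest: conn_subset)
  have type: "star_type (?g d0 d1 d2 d) (Suc 0) =
      layer_type False False False (d0 = d) (d1 = d) (d2 = d) False False False" for d0 d1 d2 d
    using star_extend(1)[of ?f 0 d0 d1 d2 d] by (simp add: none)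
  have comps: "ncomp star_adj (?g d0 d1 d2 d) (star_verts (Suc 0)) =
      4 - (of_bool (d0 = d) + of_bool (d1 = d) + of_bool (d2 = d))" for d0 d1 d2 d
    using star_extend(2)[of ?f 0 d0 d1 d2 d] by (simp add: layer_merged_def none ncomp_def)
  show ?thesis
    unfolding star_sum_def star_sum_Suc_expand star_verts_0 PiE_empty_domain single type comps
    by (simp add: sum_lessThan_2 layer_type_def algebra_simps flip: numeral_2_eq_2 numeral_3_eq_3)
qed

section \<open>Admissible configurations of a layer and lumpability\<close>

definition state_ok :: "bool \<Rightarrow> bool \<Rightarrow> bool \<Rightarrow> bool \<Rightarrow> bool \<Rightarrow> bool \<Rightarrow> bool" where
  "state_ok s0 s1 s2 e01 e02 e12 \<longleftrightarrow>
     (e01 \<longrightarrow> s0 = s1) \<and> (e02 \<longrightarrow> s0 = s2) \<and> (e12 \<longrightarrow> s1 = s2) \<and>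
     (s0 \<and> s1 \<longrightarrow> e01) \<and> (s0 \<and> s2 \<longrightarrow> e02) \<and> (s1 \<and> s2 \<longrightarrow> e12) \<and>
     (e01 \<and> e02 \<longrightarrow> e12) \<and> (e01 \<and> e12 \<longrightarrow> e02) \<and> (e02 \<and> e12 \<longrightarrow> e01)"

text \<open>With 0, 1, 2, 3 leaves differing from the center there are 1, 3, 6, 5 cases: two
  differing leaves may be connected or not, and three admit any of the five set partitions.\<close>

lemma state_ok_cases:
  assumes "state_ok s0 s1 s2 e01 e02 e12"
  shows
    "s0 \<and> s1 \<and> s2 \<and> e01 \<and> e02 \<and> e12 \<or>
     s0 \<and> s1 \<and> \<not> s2 \<and> e01 \<and> \<not> e02 \<and> \<not> e12 \<or>
     s0 \<and> \<not> s1 \<and> s2 \<and> \<not> e01 \<and> e02 \<and> \<not> e12 \<or>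
     s0 \<and> \<not> s1 \<and> \<not> s2 \<and> \<not> e01 \<and> \<not> e02 \<and> e12 \<or>
     s0 \<and> \<not> s1 \<and> \<not> s2 \<and> \<not> e01 \<and> \<not> e02 \<and> \<not> e12 \<or>
     \<not> s0 \<and> s1 \<and> s2 \<and> \<not> e01 \<and> \<not> e02 \<and> e12 \<or>
     \<not> s0 \<and> s1 \<and> \<not> s2 \<and> \<not> e01 \<and> e02 \<and> \<not> e12 \<or>
     \<not> s0 \<and> s1 \<and> \<not> s2 \<and> \<not> e01 \<and> \<not> e02 \<and> \<not> e12 \<or>
     \<not> s0 \<and> \<not> s1 \<and> s2 \<and> e01 \<and> \<not> e02 \<and> \<not> e12 \<or>
     \<not> s0 \<and> \<not> s1 \<and> s2 \<and> \<not> e01 \<and> \<not> e02 \<and> \<not> e12 \<or>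
     \<not> s0 \<and> \<not> s1 \<and> \<not> s2 \<and> e01 \<and> e02 \<and> e12 \<or>
     \<not> s0 \<and> \<not> s1 \<and> \<not> s2 \<and> e01 \<and> \<not> e02 \<and> \<not> e12 \<or>
     \<not> s0 \<and> \<not> s1 \<and> \<not> s2 \<and> \<not> e01 \<and> e02 \<and> \<not> e12 \<or>
     \<not> s0 \<and> \<not> s1 \<and> \<not> s2 \<and> \<not> e01 \<and> \<not> e02 \<and> e12 \<or>
     \<not> s0 \<and> \<not> s1 \<and> \<not> s2 \<and> \<not> e01 \<and> \<not> e02 \<and> \<not> e12"
  using assms unfolding state_ok_def by argo

text \<open>
  Lumpability: the sum over all extensions by one layer depends on the configuration of the last layer
  only through its state. Checking this on all 15 configurations (with colors taken relative to the old
  center) makes a symmetry argument unnecessary.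
\<close>

lemma layer_transfer_bool:
  fixes y :: "'a::comm_ring_1"
  assumes "state_ok s0 s1 s2 e01 e02 e12"
  shows "(\<Sum>d0\<in>UNIV. \<Sum>d1\<in>UNIV. \<Sum>d2\<in>UNIV. \<Sum>d\<in>UNIV.
      h (layer_type (s0 = d0) (s1 = d1) (s2 = d2) (d0 = d) (d1 = d) (d2 = d) e01 e02 e12) *
      y ^ (3 + of_bool (s0 \<noteq> d0) + of_bool (s1 \<noteq> d1) + of_bool (s2 \<noteq> d2) -
        layer_merged d (s0 = d0) (s1 = d1) (s2 = d2) (d0 = d) (d1 = d) (d2 = d)
          s0 s1 s2 e01 e02 e12)) =
    star_transfer y h
      (of_bool (\<not> s0) + of_bool (\<not> s1) + of_bool (\<not> s2), of_bool e01 + of_bool e02 + of_bool e12)"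
  using state_ok_cases[OF assms]
  by (elim disjE conjE)
     (simp_all add: UNIV_bool layer_type_def layer_merged_def star_transfer_def star_vec_def
        eval_nat_numeral algebra_simps)

lemma layer_transfer:
  fixes c l0 l1 l2 :: nat and y :: "'a::comm_ring_1"
  assumes c: "c = 0 \<or> c = 1" and l: "l0 = 0 \<or> l0 = 1" "l1 = 0 \<or> l1 = 1" "l2 = 0 \<or> l2 = 1"
    and ok: "state_ok (l0 = c) (l1 = c) (l2 = c) e01 e02 e12"
  shows "(\<Sum>d0<2. \<Sum>d1<2. \<Sum>d2<2. \<Sum>d<2.
      h (layer_type (l0 = d0) (l1 = d1) (l2 = d2) (d0 = d) (d1 = d) (d2 = d) e01 e02 e12) *
      y ^ (3 + of_bool (l0 \<noteq> d0) + of_bool (l1 \<noteq> d1) + of_bool (l2 \<noteq> d2) -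
        layer_merged (c = d) (l0 = d0) (l1 = d1) (l2 = d2) (d0 = d) (d1 = d) (d2 = d)
          (l0 = c) (l1 = c) (l2 = c) e01 e02 e12)) =
    star_transfer y h
      (of_bool (l0 \<noteq> c) + of_bool (l1 \<noteq> c) + of_bool (l2 \<noteq> c),
       of_bool e01 + of_bool e02 + of_bool e12)"
proof -
  \<comment> \<open>With two colors, a color is determined by whether it equals the color
    \<open>c\<close> of the old center; \<open>k\<close> reindexes the sums accordingly.\<close>
  define k where "k = (\<lambda>d. if d then c else 1 - c)"
  have reindex: "(\<Sum>d<2. g d) = (\<Sum>d\<in>UNIV. g (k d))" for g :: "nat \<Rightarrow> 'a"
    using c by (auto simp: UNIV_bool k_def sum_lessThan_2 add.commute)
  have k_inj: "k d = k d' \<longleftrightarrow> d = d'" and k_c: "c = k d \<longleftrightarrow> d" for d d'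
    using c by (auto simp: k_def)
  have k_l: "l0 = k d \<longleftrightarrow> (l0 = c) = d" "l1 = k d \<longleftrightarrow> (l1 = c) = d" "l2 = k d \<longleftrightarrow> (l2 = c) = d" for d
    using c l by (auto simp: k_def)
  show ?thesis
    unfolding reindex k_inj k_c k_l by (rule layer_transfer_bool[OF ok])
qed

text \<open>Makes the truncated subtraction in the exponents exact. The left side is at most 4, and
  equals 4 only if no leaf keeps its color, when the right side is 6.\<close>

lemma layer_merged_le:
  "layer_merged (c = d) (l0 = d0) (l1 = d1) (l2 = d2) (d0 = d) (d1 = d) (d2 = d)
     (l0 = c) (l1 = c) (l2 = c) e01 e02 e12 \<le>
   3 + of_bool (l0 \<noteq> d0) + of_bool (l1 \<noteq> d1) + of_bool (l2 \<noteq> d2)"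
  by (auto simp: layer_merged_def)

text \<open>Leaves of the center's color are connected through it, for which the layer must exist,
  hence \<open>0 < n\<close>. The other conditions come from \<open>conn\<close> preserving colors
  and being symmetric and transitive.\<close>

lemma state_ok_star:
  assumes "0 < n"
  shows "state_ok (f (Inr 0, n) = f (Inl 0, n)) (f (Inr 1, n) = f (Inl 0, n))
    (f (Inr 2, n) = f (Inl 0, n)) (leaves_conn f n 0 1) (leaves_conn f n 0 2) (leaves_conn f n 1 2)"
proof -
  let ?C = "conn star_adj f (star_verts n)"
  have col: "leaves_conn f n i j \<Longrightarrow> f (Inr i, n) = f (Inl 0, n) \<longleftrightarrow> f (Inr j, n) = f (Inl 0, n)" for i j
    unfolding leaves_conn_def by (drule conn_color) simp
  have sym: "leaves_conn f n i j \<Longrightarrow> leaves_conn f n j i" for i j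
    unfolding leaves_conn_def by (rule conn_sym[OF symp_star_adj])
  have trans: "leaves_conn f n i j \<Longrightarrow> leaves_conn f n j k \<Longrightarrow> leaves_conn f n i k" for i j k
    unfolding leaves_conn_def by (rule conn_trans)
  have centre: "leaves_conn f n i j"
    if "i \<in> {0, 1, 2}" "j \<in> {0, 1, 2}" "f (Inr i, n) = f (Inl 0, n)" "f (Inr j, n) = f (Inl 0, n)"
    for i j
  proof -
    have "((Inr i, n), (Inl 0, n)) \<in> ?C" "((Inl 0, n), (Inr j, n)) \<in> ?C"
      using that assms by (auto intro!: conn_edge simp: star_verts_def star_adj_def)
    then show ?thesis unfolding leaves_conn_def by (rule conn_trans)
  qed
  have mem: "0 \<in> {0, 1, 2 :: nat}" "1 \<in> {0, 1, 2 :: nat}" "2 \<in> {0, 1, 2 :: nat}" by simp_all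
  show ?thesis
    unfolding state_ok_def
    using col[of 0 1] col[of 0 2] col[of 1 2] centre[OF mem(1,2)] centre[OF mem(1,3)]
      centre[OF mem(2,3)] trans[of 0 1 2] trans[of 0 2 1] trans[of 1 0 2] sym[of 0 1] sym[of 0 2]
      sym[of 1 2] sym[of 2 1]
    by argo
qed

text \<open>For a fixed coloring of the first \<open>n\<close> layers, summing over the colors of
  the new layer gives a value that depends only on the state of layer \<open>n\<close>, by
  lumpability.\<close>

lemma star_sum_Suc:
  fixes y :: "'a::comm_ring_1"
  assumes "0 < n"
  shows "y\<^sup>2 * star_sum y h (Suc n) = star_sum y (star_transfer y h) n"
proof -
  have "y\<^sup>2 * (\<Sum>d0<2. \<Sum>d1<2. \<Sum>d2<2. \<Sum>d<2.
       h (star_type (f((Inr 0, Suc n) := d0, (Inr 1, Suc n) := d1, (Inr 2, Suc n) := d2,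
         (Inl 0, Suc n) := d)) (Suc n)) *
       y ^ ncomp star_adj (f((Inr 0, Suc n) := d0, (Inr 1, Suc n) := d1, (Inr 2, Suc n) := d2,
         (Inl 0, Suc n) := d)) (star_verts (Suc n))) =
      star_transfer y h (star_type f n) * y ^ ncomp star_adj f (star_verts n)"
    (is "y\<^sup>2 * (\<Sum>d0<2. \<Sum>d1<2. \<Sum>d2<2. \<Sum>d<2. h (?t d0 d1 d2 d) * y ^ ?N d0 d1 d2 d) = _")
    if f: "f \<in> star_verts n \<rightarrow>\<^sub>E {..<2 :: nat}" for f
  proof -
    define c where "c = f (Inl 0, n)"
    define l0 where "l0 = f (Inr 0, n)"
    define l1 where "l1 = f (Inr 1, n)"
    define l2 where "l2 = f (Inr 2, n)"
    define e01 where "e01 = leaves_conn f n 0 1"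
    define e02 where "e02 = leaves_conn f n 0 2"
    define e12 where "e12 = leaves_conn f n 1 2"
    let ?K = "ncomp star_adj f (star_verts n)"
    note folds = c_def[symmetric] l0_def[symmetric] l1_def[symmetric] l2_def[symmetric]
      e01_def[symmetric] e02_def[symmetric] e12_def[symmetric]
    have two: "f (v, n) = 0 \<or> f (v, n) = 1" if "v \<in> {Inl 0, Inr 0, Inr 1, Inr 2}" for v
    proof -
      have "f (v, n) \<in> {..<2}" using f that assms by (intro PiE_mem[OF f]) (auto simp: star_verts_def)
      then show ?thesis by auto
    qed
    have cols: "c = 0 \<or> c = 1" "l0 = 0 \<or> l0 = 1" "l1 = 0 \<or> l1 = 1" "l2 = 0 \<or> l2 = 1"
      unfolding c_def l0_def l1_def l2_def by (rule two, simp)+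
    have "y\<^sup>2 * (h (?t d0 d1 d2 d) * y ^ ?N d0 d1 d2 d) = y ^ ?K *
       (h (layer_type (l0 = d0) (l1 = d1) (l2 = d2) (d0 = d) (d1 = d) (d2 = d) e01 e02 e12) *
        y ^ (3 + of_bool (l0 \<noteq> d0) + of_bool (l1 \<noteq> d1) + of_bool (l2 \<noteq> d2) -
        layer_merged (c = d) (l0 = d0) (l1 = d1) (l2 = d2) (d0 = d) (d1 = d) (d2 = d)
          (l0 = c) (l1 = c) (l2 = c) e01 e02 e12))" (is "_ = _ * (_ * y ^ ?E)")
      for d0 d1 d2 d
    proof -
      have t: "?t d0 d1 d2 d =
          layer_type (l0 = d0) (l1 = d1) (l2 = d2) (d0 = d) (d1 = d) (d2 = d) e01 e02 e12"
        using star_extend(1)[of f n d0 d1 d2 d] assms unfolding folds by simp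
      \<comment> \<open>The 1 for the new center and the 2 from \<open>y\<^sup>2\<close> make up the
        3 in \<open>?E\<close>.\<close>
      have "2 + ?N d0 d1 d2 d = ?K + ?E"
        using star_extend(2)[of f n d0 d1 d2 d] assms
          layer_merged_le[of c d l0 d0 l1 d1 l2 d2 e01 e02 e12]
        unfolding folds by simp
      then have "y\<^sup>2 * y ^ ?N d0 d1 d2 d = y ^ ?K * y ^ ?E"
        unfolding power_add[symmetric] by (rule arg_cong)
      then show ?thesis
        unfolding t mult.left_commute[of "y\<^sup>2"] mult.left_commute[of "y ^ ?K"] by (rule arg_cong)
    qed
    then have "y\<^sup>2 * (\<Sum>d0<2. \<Sum>d1<2. \<Sum>d2<2. \<Sum>d<2. h (?t d0 d1 d2 d) * y ^ ?N d0 d1 d2 d) =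
      y ^ ?K * (\<Sum>d0<2. \<Sum>d1<2. \<Sum>d2<2. \<Sum>d<2.
       (h (layer_type (l0 = d0) (l1 = d1) (l2 = d2) (d0 = d) (d1 = d) (d2 = d) e01 e02 e12) *
        y ^ (3 + of_bool (l0 \<noteq> d0) + of_bool (l1 \<noteq> d1) + of_bool (l2 \<noteq> d2) -
        layer_merged (c = d) (l0 = d0) (l1 = d1) (l2 = d2) (d0 = d) (d1 = d) (d2 = d)
          (l0 = c) (l1 = c) (l2 = c) e01 e02 e12)))"
      by (simp only: sum_distrib_left)
    also have "\<dots> = y ^ ?K * star_transfer y h (star_type f n)"
      unfolding layer_transfer[OF cols state_ok_star[OF assms, of f, unfolded folds]]
      by (simp only: star_type_def folds)
    finally show ?thesis by (simp only: mult.commute)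
  qed
  then show ?thesis
    unfolding star_sum_def star_sum_Suc_expand sum_distrib_left[of "y\<^sup>2" _ "star_verts n \<rightarrow>\<^sub>E {..<2}"]
    by (intro sum.cong refl)
qed

section \<open>The generating function\<close>

text \<open>Entry \<open>i\<close> is the coefficient of \<open>x^i\<close>, listed by ascending
  powers of \<open>y\<close>; likewise for \<open>p_coeffs\<close>.\<close>

definition q_coeffs :: "int poly list" where
  "q_coeffs =
     [[:1:],
      [:-9, -7, -1, -1, -1:],
      [:28, 14, -6, -4, 11, 5, 1, 1:],
      [:-44, -18, 54, 7, -11, -22, 5, 1, -3, -1:],
      [:39, -1, -105, 42, 45, -32, 20, 2, -17, 7:],
      [:-19, 6, 83, -50, -125, 167, -62, -28, 47, -24, 4, 1:],
      [:4, 11, -91, 116, 116, -409, 365, -61, -122, 94, -24, 1:],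
      [:0, -5, 18, 18, -183, 355, -289, 45, 95, -74, 23, -3:]]"

definition p_coeffs :: "int poly list" where
  "p_coeffs =
     [0,
      [:0, 2, 6, 6, 2:],
      [:0, -16, 4, -44, 40, -28, 4, -8:],
      [:0, 40, -52, 90, -32, -106, 104, -4, -22, 14:],
      [:0, -48, 92, -80, 16, 64, 52, -204, 124, -8, -8:],
      [:0, 30, -48, -120, 468, -662, 384, 112, -268, 110, 4, -10:],
      [:0, -8, -12, 168, -316, 0, 708, -1028, 656, -156, -28, 16:],
      [:0, 0, 10, -36, -26, 340, -756, 852, -562, 228, -58, 8:]]"

text \<open>
  If \<open>c\<close> is the row vector of ones, then row \<open>j\<close> is \<open>y\<^sup>2\<^sup>j (q\<^sub>0 c M\<^sup>j + \<dots> + q\<^sub>j c)\<close>, which vanishes at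
  \<open>j = 7\<close> by Cayley-Hamilton.
\<close>

primrec star_row :: "nat \<Rightarrow> nat \<times> nat \<Rightarrow> int poly" where
  "star_row 0 = star_vec 1 1 1 1 1 1 1"
| "star_row (Suc j) =
     (\<lambda>t. star_transfer [:0, 1:] (star_row j) t + [:0, 1:] ^ (2 * Suc j) * q_coeffs ! Suc j)"

section \<open>Evaluating the rows on coefficient lists\<close>

lemma star_vec_add: "(\<lambda>t. star_vec a b c d e f g t + k) =
    star_vec (a + k) (b + k) (c + k) (d + k) (e + k) (f + k) (g + k)"
  by (auto simp: star_vec_def fun_eq_iff)

lemma X_power_mult: "[:0, 1:] ^ n * p = (pCons 0 ^^ n) p" for p :: "'a::comm_ring_1 poly"
  by (induction n) simp_all

text \<open>Powers of \<open>y\<close> become shifts \<open>pCons 0\<close> and numerical factors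
  become \<open>smult\<close>, so rows can be evaluated directly on coefficient lists.\<close>

lemma star_transfer_vec:
  "star_transfer [:0, 1:] (star_vec a b c d e f g) = star_vec
     (pCons 0 (pCons 0 a) + pCons 0 (pCons 0 (pCons 0 a)) + smult 6 (pCons 0 (pCons 0 (pCons 0 b))) + smult 3 (pCons 0 (pCons 0 (pCons 0 (pCons 0 c)))) + smult 3 (pCons 0 (pCons 0 (pCons 0 d))) + pCons 0 (pCons 0 (pCons 0 (pCons 0 (pCons 0 e)))) + pCons 0 (pCons 0 (pCons 0 g)))
     (smult 2 (pCons 0 (pCons 0 a)) + smult 3 (pCons 0 (pCons 0 b)) + smult 2 (pCons 0 (pCons 0 (pCons 0 b))) + pCons 0 (pCons 0 (pCons 0 (pCons 0 b))) + smult 2 (pCons 0 (pCons 0 (pCons 0 c))) + smult 3 (pCons 0 (pCons 0 (pCons 0 (pCons 0 c)))) + pCons 0 (pCons 0 d) + pCons 0 (pCons 0 (pCons 0 (pCons 0 e))) + pCons 0 (pCons 0 (pCons 0 (pCons 0 f))))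
     (pCons 0 a + pCons 0 (pCons 0 a) + pCons 0 b + smult 2 (pCons 0 (pCons 0 b)) + smult 3 (pCons 0 (pCons 0 (pCons 0 b))) + pCons 0 (pCons 0 c) + smult 4 (pCons 0 (pCons 0 (pCons 0 c))) + pCons 0 (pCons 0 (pCons 0 (pCons 0 (pCons 0 c)))) + pCons 0 (pCons 0 (pCons 0 e)) + pCons 0 (pCons 0 (pCons 0 (pCons 0 (pCons 0 e)))))
     (smult 2 (pCons 0 (pCons 0 a)) + smult 3 (pCons 0 (pCons 0 b)) + smult 3 (pCons 0 (pCons 0 (pCons 0 b))) + smult 4 (pCons 0 (pCons 0 (pCons 0 c))) + pCons 0 (pCons 0 (pCons 0 (pCons 0 (pCons 0 c)))) + pCons 0 (pCons 0 d) + pCons 0 (pCons 0 (pCons 0 (pCons 0 (pCons 0 e)))) + pCons 0 (pCons 0 (pCons 0 f)))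
     (a + pCons 0 (pCons 0 a) + smult 6 (pCons 0 (pCons 0 b)) + smult 3 (pCons 0 (pCons 0 c)) + smult 3 (pCons 0 (pCons 0 (pCons 0 (pCons 0 c)))) + pCons 0 (pCons 0 e) + pCons 0 (pCons 0 (pCons 0 (pCons 0 (pCons 0 (pCons 0 e))))))
     (pCons 0 a + pCons 0 (pCons 0 a) + smult 5 (pCons 0 (pCons 0 b)) + pCons 0 (pCons 0 (pCons 0 b)) + smult 2 (pCons 0 (pCons 0 c)) + smult 3 (pCons 0 (pCons 0 (pCons 0 (pCons 0 c)))) + pCons 0 (pCons 0 d) + pCons 0 (pCons 0 (pCons 0 (pCons 0 (pCons 0 (pCons 0 e))))) + pCons 0 (pCons 0 f))
     (smult 2 (pCons 0 (pCons 0 a)) + smult 3 (pCons 0 (pCons 0 b)) + smult 3 (pCons 0 (pCons 0 (pCons 0 b))) + smult 3 (pCons 0 (pCons 0 (pCons 0 (pCons 0 c)))) + smult 3 (pCons 0 (pCons 0 d)) + pCons 0 (pCons 0 (pCons 0 (pCons 0 (pCons 0 (pCons 0 e))))) + pCons 0 (pCons 0 g))" for a :: "int poly"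
  unfolding star_transfer_def mult.assoc X_power_mult
  by (simp add: star_vec_def eval_nat_numeral numeral_mult_conv_smult)

lemmas star_row_eval = one_pCons eval_nat_numeral star_vec_add star_transfer_vec X_power_mult
  q_coeffs_def

text \<open>The Cayley-Hamilton relation for the row of ones, checked by evaluating the rows
  outright.\<close>

lemma star_row_7: "star_row 7 = (\<lambda>_. 0)"
proof -
  have "star_row 7 = star_vec 0 0 0 0 0 0 0"
    by (simp add: star_row_eval del: one_poly_eq_simps)
  then show ?thesis by (simp add: star_vec_def fun_eq_iff)
qed

text \<open>With \<open>t_n\<close> the coefficients of the series, \<open>q T = p\<close> demands
  \<open>p_(j+1) = q_0 t_(j+1) + ... + q_j t_1\<close>. Transferring every \<open>t_n\<close> back
  to layer 1 turns the right side, up to the factor \<open>y^(2j)\<close>, into the sum weighted by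
  row \<open>j\<close>.\<close>

lemma star_sum_row_1:
  assumes "j < 7"
  shows "star_sum [:0, 1:] (star_row j) (Suc 0) = [:0, 1:] ^ (2 * j) * p_coeffs ! Suc j"
proof -
  have vec_1: "star_sum [:0, 1:] (star_vec a b c d e f g) (Suc 0) =
      smult 2 (pCons 0 a) + smult 6 (pCons 0 (pCons 0 b)) +
      smult 6 (pCons 0 (pCons 0 (pCons 0 c))) +
      smult 2 (pCons 0 (pCons 0 (pCons 0 (pCons 0 e))))" for a b c d e f g :: "int poly"
    unfolding star_sum_1 mult.assoc X_power_mult
    by (simp add: star_vec_def eval_nat_numeral numeral_mult_conv_smult)
  consider "j = 0" | "j = 1" | "j = 2" | "j = 3" | "j = 4" | "j = 5" | "j = 6"
    using assms by linarith
  then show ?thesis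
    by cases (simp_all add: vec_1 p_coeffs_def star_row_eval del: one_poly_eq_simps)
qed

lemma star_sum_row_Suc:
  assumes "0 < n"
  shows "[:0, 1:]\<^sup>2 * star_sum [:0, 1:] (star_row j) (Suc n) =
    star_sum [:0, 1:] (star_row (Suc j)) n -
    [:0, 1:] ^ (2 * Suc j) * q_coeffs ! Suc j * star_sum [:0, 1:] (\<lambda>_. 1) n"
  unfolding star_sum_Suc[OF assms]
  by (simp add: star_sum_def distrib_right sum.distrib sum_distrib_left del: power_Suc mult_Suc_right)

section \<open>From sums over colorings to power series\<close>

lemma fps_nth_partition_genfun:
  "fps_nth partition_genfun n = (if n = 0 then 0 else star_sum [:0, 1:] (\<lambda>_. 1) n)"
proof -
  let ?G = "cartesian_product (complete_bipartite 1 3) (path_graph n)"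
  have "(\<Sum>T\<in>colored_partitions 2 ?G. [:0, 1:] ^ num_blocks T) = star_sum [:0, 1 :: int:] (\<lambda>_. 1) n"
    unfolding sum_colored_partitions verts_star_path star_sum_def mult_1
    by (intro sum.cong refl arg_cong[where f = "power _"] ncomp_cong edges_star_path)
  then show ?thesis by (simp add: partition_genfun_def)
qed

lemma p_poly_fps:
  "p_poly fps_X (fps_const [:0, 1:]) = (\<Sum>i\<le>7. fps_const (p_coeffs ! i) * fps_X ^ i)"
  unfolding p_poly_def numeral_fps_const
  by (simp add: eval_nat_numeral one_pCons numeral_poly p_coeffs_def del: one_poly_eq_simps)

lemma q_poly_fps:
  "q_poly fps_X (fps_const [:0, 1:]) = (\<Sum>i\<le>7. fps_const (q_coeffs ! i) * fps_X ^ i)"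
  unfolding q_poly_def numeral_fps_const
  by (simp add: eval_nat_numeral one_pCons numeral_poly q_coeffs_def del: one_poly_eq_simps)

lemma q_poly_mult_partition_genfun:
  "q_poly fps_X (fps_const [:0, 1:]) * partition_genfun = p_poly fps_X (fps_const [:0, 1:])"
proof -
  define Y where "Y = fps_const [:0, 1 :: int:]"
  define L where
    "L j = Abs_fps (\<lambda>n. if n = 0 then 0 else star_sum [:0, 1:] (star_row j) n)" for j
  let ?T = partition_genfun
  let ?p = "\<lambda>i. fps_const (p_coeffs ! i)" and ?q = "\<lambda>i. fps_const (q_coeffs ! i)"
  have L_step: "Y\<^sup>2 * L j =
      fps_X * (Y ^ (2 * Suc j) * ?p (Suc j) + L (Suc j) - Y ^ (2 * Suc j) * ?q (Suc j) * ?T)"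
    if "j < 7" for j
  proof (rule fps_ext)
    fix n
    have pow: "Y ^ k * fps_const c = fps_const ([:0, 1:] ^ k * c)" for k c
      by (simp add: Y_def)
    have Y2: "Y\<^sup>2 = fps_const ([:0, 1:]\<^sup>2)" by (simp add: Y_def)
    \<comment> \<open>The coefficient at 1 comes from the first layer and yields the term of
      \<open>p\<close>; from 2 on the recurrence between layers applies.\<close>
    consider "n = 0" | "n = 1" | m where "n = Suc m" "0 < m" by (cases n) auto
    then show "fps_nth (Y\<^sup>2 * L j) n = fps_nth (fps_X * (Y ^ (2 * Suc j) * ?p (Suc j) +
        L (Suc j) - Y ^ (2 * Suc j) * ?q (Suc j) * ?T)) n"
    proof cases
      case 1
      then show ?thesis by (simp add: Y2 L_def)
    next
      case 2
      have "[:0, 1:]\<^sup>2 * ([:0, 1:] ^ (2 * j) * p_coeffs ! Suc j) =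
          [:0, 1:] ^ (2 * Suc j) * p_coeffs ! Suc j"
        by (simp only: mult.assoc[symmetric] power_add[symmetric]) simp
      then show ?thesis
        unfolding 2 pow Y2 fps_mult_left_const_nth fps_X_mult_nth
        by (simp add: L_def fps_nth_partition_genfun star_sum_row_1[OF that] del: power_Suc mult_Suc_right)
    next
      case 3
      then show ?thesis
        unfolding pow Y2 fps_mult_left_const_nth fps_X_mult_nth fps_sub_nth fps_add_nth
        by (simp add: L_def fps_nth_partition_genfun star_sum_row_Suc
            del: power_Suc mult_Suc_right star_row.simps)
    qed
  qed
  \<comment> \<open>Multiplying the series by a partial sum of \<open>q\<close> gives the partial
    sum of \<open>p\<close> up to the remainder \<open>fps_X ^ j * L j\<close>; each
    \<open>L_step\<close> exchanges the remainder for the next terms.\<close>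
  have main: "Y ^ (2 * j) * (\<Sum>i\<le>j. ?q i * fps_X ^ i) * ?T =
      Y ^ (2 * j) * (\<Sum>i\<le>j. ?p i * fps_X ^ i) + fps_X ^ j * L j" if "j \<le> 7" for j
    using that
  proof (induction j)
    case 0
    have "star_row 0 = (\<lambda>_. 1)" by (auto simp: star_vec_def)
    then have "L 0 = ?T" by (simp add: L_def fps_eq_iff fps_nth_partition_genfun)
    then show ?case by (simp add: q_coeffs_def p_coeffs_def)
  next
    case (Suc j)
    define A where "A = (\<Sum>i\<le>j. ?q i * fps_X ^ i)"
    define B where "B = (\<Sum>i\<le>j. ?p i * fps_X ^ i)"
    define Z where "Z = Y ^ (2 * Suc j)"
    have Z: "Z = Y\<^sup>2 * Y ^ (2 * j)" by (simp add: Z_def power2_eq_square)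
    have "Y ^ (2 * j) * A * ?T = Y ^ (2 * j) * B + fps_X ^ j * L j"
      using Suc by (simp add: A_def B_def)
    then have IH: "Z * A * ?T = Z * B + fps_X ^ j * (Y\<^sup>2 * L j)"
      unfolding Z by (simp only: mult.assoc distrib_left mult.left_commute[of "Y\<^sup>2" "fps_X ^ j"])
    have "Z * (A + ?q (Suc j) * fps_X ^ Suc j) * ?T =
        Z * B + fps_X ^ j * (Y\<^sup>2 * L j) + Z * (?q (Suc j) * fps_X ^ Suc j) * ?T"
      unfolding IH[symmetric] by (simp only: distrib_left distrib_right)
    also have "\<dots> = Z * (B + ?p (Suc j) * fps_X ^ Suc j) + fps_X ^ Suc j * L (Suc j)"
      unfolding L_step[OF Suc_le_lessD[OF Suc.prems]] Z_def[symmetric]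
      by (simp add: algebra_simps)
    finally show ?case by (simp only: sum.atMost_Suc A_def B_def Z_def)
  qed
  \<comment> \<open>The remainder vanishes because row 7 is zero; the nonzero factor
    \<open>Y ^ 14\<close> is then cancelled.\<close>
  have "L 7 = 0" by (simp add: L_def star_row_7 star_sum_def fps_eq_iff)
  then have "Y ^ 14 * (q_poly fps_X Y * ?T) = Y ^ 14 * p_poly fps_X Y"
    using main[of 7] by (simp add: p_poly_fps q_poly_fps Y_def mult.assoc)
  then show ?thesis by (simp add: Y_def)
qed

theorem theorem7p1:
  fixes x y :: "int poly fps"
  defines "x \<equiv> fps_X" and "y \<equiv> fps_const [:0, 1:]"
  shows "to_fract partition_genfun = to_fract (p_poly x y) / to_fract (q_poly x y)"
proof -
  \<comment> \<open>Constant term 1 in \<open>x\<close> makes the denominator nonzero, so it may be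
    divided by in the fraction field.\<close>
  have "fps_nth (q_poly x y) 0 = 1"
    by (simp add: q_poly_def x_def)
  then have "q_poly x y \<noteq> 0" by auto
  moreover have "to_fract (q_poly x y) * to_fract partition_genfun = to_fract (p_poly x y)"
    using q_poly_mult_partition_genfun unfolding x_def y_def by (simp flip: to_fract_mult)
  ultimately show ?thesis by (simp add: field_simps)
qed

end
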